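(* Let $t$ be a fixed positive integer. Let $\mathfrak{U}_{t}^{0}$ be the class of all finite supersoluble groups in which every Sylow subgroup is $\mathrm{K}$-$\mathbb{P}_{t}$-subnormal. The class $\mathfrak{H}$ of all finite groups in which every Sylow subgroup is $\mathrm{K}$-$\mathbb{P}_{t}$-subnormal coincides with the class of all finite groups in which every Sylow subgroup is $\mathfrak{U}_{t}^{0}$-subnormal, i.e. $\mathfrak{H}=\mathrm{w}\mathfrak{U}_{t}^{0}$.
   Context: All groups are finite, and $t$ is a fixed natural number ($t\ge 1$). A subgroup $H$ of a group $G$ is called $\mathrm{K}$-$\mathbb{P}_{t}$-subnormal in $G$ if there exists a chain of subgroups $H=H_{0}\leq H_{1}\leq\cdots\leq H_{n-1}\leq H_{n}=G$ such that for every $i=1,\ldots,n$ either $H_{i-1}\unlhd H_{i}$, or $|H_{i}:H_{i-1}|$ is a prime $p$ such that $p-1$ is not divisible by the $(t+1)$th power of any prime. "Every Sylow subgroup of $G$" refers to all Sylow $q$-subgroups of $G$ for all primes $q$, and each is required to have the stated property in $G$. A formation is a class of groups closed under quotients and such that $G/N_1,G/N_2\in\mathfrak{F}$ with $N_1,N_2\unlhd G$ implies $G/(N_1\cap N_2)\in\mathfrak{F}$. For a non-empty formation $\mathfrak{F}$, $G^{\mathfrak{F}}$ denotes the $\mathfrak{F}$-residual of $G$, the least normal subgroup of $G$ with $G/G^{\mathfrak{F}}\in\mathfrak{F}$. A subgroup $H$ of $G$ is $\mathfrak{F}$-subnormal in $G$ if either $H=G$ or there is a chain of subgroups $H=H_{0}\leq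 H_{1}\leq\cdots\leq H_{n}=G$ such that $H_{i}^{\mathfrak{F}}\leq H_{i-1}$ for every $i=1,\ldots,n$. The class $\mathfrak{U}_{t}^{0}$ is a formation. $\mathrm{w}\mathfrak{F}$ denotes the class of all groups $G$ such that $\pi(G)\subseteq\pi(\mathfrak{F})$ and every Sylow subgroup of $G$ is $\mathfrak{F}$-subnormal in $G$, where $\pi(G)$ is the set of prime divisors of $|G|$ and $\pi(\mathfrak{F})$ is the set of all primes dividing $|G|$ for some $G\in\mathfrak{F}$. *)

theory Defs
  imports "HOL-Algebra.Elementary_Groups" "HOL-Computational_Algebra.Primes"
begin

definition finite_group :: "('a, 'b) monoid_scheme \<Rightarrow> bool" where
  "finite_group G \<longleftrightarrow> group G \<and> finite (carrier G)"

text \<open>Every finite group is isomorphic to one whose carrier is a set of natural numbers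
  (lemma \<open>finite_group_iso_nat\<close>), so a class of finite groups is represented by a set of
  groups over \<open>nat\<close>. A finite group over any type belongs to the class if it is
  isomorphic to one of these representatives.\<close>

type_synonym group_class = "nat monoid set"

definition in_class :: "('a, 'b) monoid_scheme \<Rightarrow> group_class \<Rightarrow> bool" where
  "in_class G \<FF> \<longleftrightarrow> finite_group G \<and> (\<exists>K\<in>\<FF>. finite_group K \<and> G \<cong> K)"

lemma finite_group_iso_nat:
  fixes G :: "('a, 'b) monoid_scheme"
  assumes "finite_group G"
  shows "\<exists>K :: nat monoid. finite_group K \<and> G \<cong> K"
proof -
  interpret group G using assms by (simp add: finite_group_def)
  have fin: "finite (carrier G)" using assms by (simp add: finite_group_def)
  then obtain f :: "'a \<Rightarrow> nat" where f: "inj_on f (carrier G)"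
    using finite_imp_inj_to_nat_seg by metis
  define K :: "nat monoid" where "K = \<lparr>carrier = f ` carrier G,
     monoid.mult = (\<lambda>x y. f (inv_into (carrier G) f x \<otimes>\<^bsub>G\<^esub> inv_into (carrier G) f y)),
     monoid.one = f \<one>\<^bsub>G\<^esub>\<rparr>"
  have "group K"
  proof (rule groupI)
    fix x assume "x \<in> carrier K"
    then obtain a where a: "a \<in> carrier G" "x = f a" by (auto simp: K_def)
    then show "\<exists>y\<in>carrier K. y \<otimes>\<^bsub>K\<^esub> x = \<one>\<^bsub>K\<^esub>"
      using f by (intro bexI[of _ "f (inv\<^bsub>G\<^esub> a)"]) (auto simp: K_def)
  qed (use f in \<open>auto simp: K_def m_assoc\<close>)
  moreover have "f \<in> iso G K"
    using f by (auto simp: iso_def hom_def bij_betw_def K_def)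
  ultimately show ?thesis
    using fin by (auto simp: finite_group_def is_iso_def K_def intro!: exI[of _ K])
qed

definition group_primes :: "('a, 'b) monoid_scheme \<Rightarrow> nat set" where
  "group_primes G = {p. prime p \<and> p dvd order G}"

definition class_primes :: "group_class \<Rightarrow> nat set" where
  "class_primes \<FF> = (\<Union>K \<in> {K \<in> \<FF>. finite_group K}. group_primes K)"

definition sylow_subgroup :: "nat \<Rightarrow> 'a set \<Rightarrow> ('a, 'b) monoid_scheme \<Rightarrow> bool" where
  "sylow_subgroup q P G \<longleftrightarrow>
     prime q \<and> subgroup P G \<and> card P = q ^ multiplicity q (order G)"

definition supersoluble :: "('a, 'b) monoid_scheme \<Rightarrow> bool" where
  "supersoluble G \<longleftrightarrow> (\<exists>(N :: nat \<Rightarrow> 'a set) n.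
     N 0 = {\<one>\<^bsub>G\<^esub>} \<and> N n = carrier G \<and> (\<forall>i\<le>n. N i \<lhd> G) \<and>
     (\<forall>i<n. N i \<subseteq> N (Suc i) \<and>
        cyclic_group ((G\<lparr>carrier := N (Suc i)\<rparr>) Mod (N i))))"

definition subgroup_index :: "('a, 'b) monoid_scheme \<Rightarrow> 'a set \<Rightarrow> 'a set \<Rightarrow> nat" where
  "subgroup_index G K H = card (rcosets\<^bsub>G\<lparr>carrier := K\<rparr>\<^esub> H)"

definition KP_subnormal ::
    "nat \<Rightarrow> 'a set \<Rightarrow> ('a, 'b) monoid_scheme \<Rightarrow> bool" where
  "KP_subnormal t H G \<longleftrightarrow> (\<exists>(C :: nat \<Rightarrow> 'a set) n.
     C 0 = H \<and> C n = carrier G \<and> (\<forall>i\<le>n. subgroup (C i) G) \<and>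
     (\<forall>i<n. C i \<subseteq> C (Suc i) \<and>
        (C i \<lhd> (G\<lparr>carrier := C (Suc i)\<rparr>) \<or>
         (\<exists>p. prime p \<and> subgroup_index G (C (Suc i)) (C i) = p \<and>
              (\<forall>q. prime q \<longrightarrow> \<not> q ^ (t + 1) dvd (p - 1))))))"

text \<open>\<open>LEAST\<close> refers to inclusion. It is meaningful when \<open>\<FF>\<close> is a non-empty formation.\<close>

definition residual :: "group_class \<Rightarrow> ('a, 'b) monoid_scheme \<Rightarrow> 'a set" where
  "residual \<FF> G = (LEAST N. N \<lhd> G \<and> in_class (G Mod N) \<FF>)"

definition F_subnormal ::
    "group_class \<Rightarrow> 'a set \<Rightarrow> ('a, 'b) monoid_scheme \<Rightarrow> bool" where
  "F_subnormal \<FF> H G \<longleftrightarrow> H = carrier G \<or> (\<exists>(C :: nat \<Rightarrow> 'a set) n.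
     C 0 = H \<and> C n = carrier G \<and> (\<forall>i\<le>n. subgroup (C i) G) \<and>
     (\<forall>i<n. C i \<subseteq> C (Suc i) \<and>
        residual \<FF> (G\<lparr>carrier := C (Suc i)\<rparr>) \<subseteq> C i))"

definition in_H :: "nat \<Rightarrow> ('a, 'b) monoid_scheme \<Rightarrow> bool" where
  "in_H t G \<longleftrightarrow> finite_group G \<and>
     (\<forall>q P. sylow_subgroup q P G \<longrightarrow> KP_subnormal t P G)"

definition U0 :: "nat \<Rightarrow> group_class" where
  "U0 t = {K. finite_group K \<and> supersoluble K \<and>
     (\<forall>q P. sylow_subgroup q P K \<longrightarrow> KP_subnormal t P K)}"

definition in_w :: "group_class \<Rightarrow> ('a, 'b) monoid_scheme \<Rightarrow> bool" where
  "in_w \<FF> G \<longleftrightarrow> finite_group G \<and> group_primes G \<subseteq> class_primes \<FF> \<and>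
     (\<forall>q P. sylow_subgroup q P G \<longrightarrow> F_subnormal \<FF> P G)"

end

theory Submission
  imports Defs "HOL-Algebra.Sylow" "HOL-Algebra.SndIsomorphismGrp" "HOL-Algebra.Multiplicative_Group"
begin

text \<open>Call a prime \<open>p\<close> good if \<open>p - 1\<close> is not divisible by the \<open>(t + 1)\<close>th power of any prime; these are
  the indices allowed for the non-normal steps of a \<open>KP\<close> chain. The proof rests on a local
  description of the class \<open>U0 t\<close>: a finite group \<open>K\<close> belongs to it iff it has a chain of normal subgroups from
  \<open>1\<close> to \<open>K\<close> in which every step \<open>A \<subseteq> B\<close> is central in \<open>K\<close> or has a good prime as index
  (\<open>supersoluble_KP_sylows_iff\<close>). The point is that a section \<open>B/A\<close> of prime order \<open>p\<close>, \<open>p\<close> not good, is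
  central as soon as all Sylow subgroups are \<open>KP\<close>-subnormal: let \<open>Q\<close> be a Sylow \<open>q\<close>-subgroup. If \<open>q = p\<close>, then
  \<open>Q\<close> is a \<open>p\<close>-group acting on a group of order \<open>p\<close>. If \<open>q \<noteq> p\<close>, climb a \<open>KP\<close> chain from \<open>Q\<close> to the
  whole group. Somewhere the intersection with \<open>B\<close> first leaves \<open>A\<close>; that step cannot have
  prime index, because the index would be \<open>p\<close>, so it is normal, and then \<open>Q\<close> centralizes \<open>B/A\<close>.

  The condition on chains passes to intersections of normal subgroups and along epimorphisms, so it
  describes the residual: \<open>residual (U0 t) G\<close> is the least normal subgroup above which \<open>G\<close> has such a chain
  (\<open>residual_U0\<close>). Multiplying such a chain by a subgroup \<open>M\<close> that contains its bottom gives a \<open>KP\<close> chain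
  from \<open>M\<close> to \<open>G\<close>. Hence every step of an \<open>F\<close>-subnormal chain refines to a \<open>KP\<close> chain
  (\<open>KP_steps_of_F_step\<close>), which is one inclusion.

  For the other inclusion let all Sylow subgroups of \<open>G\<close> be \<open>KP\<close>-subnormal. The Sylow subgroup
  for the largest prime divisor is normal (\<open>largest_prime_normal\<close>), and this repeats in the quotient, so
  \<open>G\<close> has a normal series with factors of prime power order
  (\<open>primary_steps_of_KP_sylows\<close>), and so has each of its subgroups. Thanks to that series, a normal step of a
  \<open>KP\<close> chain refines to normal steps of prime index, whose quotients are abelian. A
  step \<open>M \<subseteq> B\<close> of good prime index \<open>p\<close> is treated in the spirit of Galois' theorem on soluble groups
  of prime degree: modulo a normal subgroup of \<open>B\<close> inside \<open>M\<close>, the group \<open>B\<close> is an extension of a group of order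
  \<open>p\<close> by an abelian group (\<open>U0_steps_below_good_index\<close>). In both cases the residual of the
  larger group lies in the smaller one (\<open>F_steps_of_KP_step\<close>).

  To avoid quotient groups, chains are reflexive-transitive closures of step relations on the
  subgroups of a fixed ambient group, and \<open>H #> x = H #> y\<close> expresses equality modulo \<open>H\<close>.\<close>

section \<open>Indices and quotients in finite groups\<close>

lemma (in group) subgroup_index_mult_card:
  assumes "subgroup A G" "subgroup B G" "A \<subseteq> B"
  shows "subgroup_index G B A * card A = card B"
proof -
  interpret B: group "G\<lparr>carrier := B\<rparr>"
    using assms(2) by (rule subgroup.subgroup_is_group) (rule is_group)
  have "subgroup A (G\<lparr>carrier := B\<rparr>)"
    using assms by (simp add: subgroup_incl)
  from B.lagrange[OF this] show ?thesis
    by (simp add: subgroup_index_def order_def)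
qed

lemma (in group) card_subgroup_pos:
  assumes "subgroup A G" "finite (carrier G)"
  shows "card A > 0"
  using assms by (metis card_gt_0_iff empty_iff finite_subset subgroup.one_closed subgroup.subset)

lemma (in group) card_subgroup_dvd:
  assumes "subgroup A G" "subgroup B G" "A \<subseteq> B"
  shows "card A dvd card B"
  using subgroup_index_mult_card[OF assms] by (metis dvd_triv_right)

lemma (in group) normal_subgroup_iff:
  assumes "subgroup K G"
  shows "A \<lhd> (G\<lparr>carrier := K\<rparr>) \<longleftrightarrow>
    subgroup A G \<and> A \<subseteq> K \<and> (\<forall>x\<in>K. \<forall>a\<in>A. x \<otimes> a \<otimes> inv x \<in> A)"
proof -
  interpret K: group "G\<lparr>carrier := K\<rparr>"
    using assms by (rule subgroup.subgroup_is_group) (rule is_group)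
  have *: "subgroup A (G\<lparr>carrier := K\<rparr>) \<longleftrightarrow> subgroup A G \<and> A \<subseteq> K"
    using assms subgroup_incl incl_subgroup[OF assms] subgroup.subset by fastforce
  show ?thesis
    using assms * by (auto simp: K.normal_inv_iff m_inv_consistent)
qed

lemma (in group) normal_in_subgroup:
  assumes "subgroup K G" "A \<lhd> G" "A \<subseteq> K"
  shows "A \<lhd> (G\<lparr>carrier := K\<rparr>)"
  using assms unfolding normal_subgroup_iff[OF assms(1)] normal_inv_iff
  by (meson subgroup.mem_carrier)

lemma (in group_hom) card_image_kernel:
  assumes S: "subgroup S G" and fin: "finite S"
  shows "card S = card (h ` S) * card {x \<in> S. h x = \<one>\<^bsub>H\<^esub>}"
proof -
  note [simp] = subgroup.mem_carrier[OF S] subgroup.m_closed[OF S] subgroup.m_inv_closed[OF S]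
  have fib: "card {x \<in> S. h x = y} = card {x \<in> S. h x = \<one>\<^bsub>H\<^esub>}" if y: "y \<in> h ` S" for y
  proof -
    obtain s where s: "s \<in> S" "y = h s" using y by auto
    have "bij_betw (\<lambda>x. x \<otimes> s) {x \<in> S. h x = \<one>\<^bsub>H\<^esub>} {x \<in> S. h x = y}"
      using s by (intro bij_betw_byWitness[where f' = "\<lambda>x. x \<otimes> inv s"]) (auto simp: G.m_assoc)
    then show ?thesis by (rule bij_betw_same_card[symmetric])
  qed
  have "card S = (\<Sum>y\<in>h ` S. card {x \<in> S. h x = y})"
    using sum.image_gen[OF fin, of "\<lambda>_. 1::nat" h] by simp
  also have "\<dots> = card (h ` S) * card {x \<in> S. h x = \<one>\<^bsub>H\<^esub>}"
    using fib by simp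
  finally show ?thesis .
qed

lemma (in normal) quotient_hom: "group_hom G (G Mod H) (\<lambda>x. H #> x)"
  by (intro group_hom.intro group_hom_axioms.intro r_coset_hom_Mod is_group factorgroup_is_group)

lemma (in normal) coset_eq_iff:
  assumes "x \<in> carrier G" "y \<in> carrier G"
  shows "H #> x = H #> y \<longleftrightarrow> x \<otimes> inv y \<in> H"
proof -
  have "H #> x = H #> y \<longleftrightarrow> x \<in> H #> y"
    using assms by (metis repr_independence rcos_self subgroup_axioms)
  then show ?thesis using assms rcos_module[OF is_group] by auto
qed

lemma (in normal) coset_eq_self_iff:
  assumes "x \<in> carrier G"
  shows "H #> x = H \<longleftrightarrow> x \<in> H"
  using coset_eq_iff[OF assms one_closed] assms subset by simp

lemma (in normal) mem_set_mult_iff: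
  assumes S: "subgroup S G" and x: "x \<in> carrier G"
  shows "x \<in> H <#> S \<longleftrightarrow> (\<exists>s\<in>S. H #> x = H #> s)"
proof
  assume "x \<in> H <#> S"
  then obtain h s where hs: "h \<in> H" "s \<in> S" "x = h \<otimes> s" by (auto simp: set_mult_def)
  then have "x \<otimes> inv s = h" using S subset by (simp add: m_assoc subgroup.mem_carrier)
  then show "\<exists>s\<in>S. H #> x = H #> s" using hs S x coset_eq_iff by (metis subgroup.mem_carrier)
next
  assume "\<exists>s\<in>S. H #> x = H #> s"
  then obtain s where s: "s \<in> S" "H #> x = H #> s" by auto
  have sc: "s \<in> carrier G" using s S subgroup.mem_carrier by metis
  have "x \<otimes> inv s \<in> H" using s sc x coset_eq_iff by auto
  moreover have "x = (x \<otimes> inv s) \<otimes> s" using x sc by (simp add: m_assoc)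
  ultimately show "x \<in> H <#> S" using s unfolding set_mult_def by blast
qed

lemma (in normal) subgroup_set_mult:
  assumes "subgroup S G"
  shows "subgroup (H <#> S) G"
proof -
  interpret second_isomorphism_grp H G S
    using assms by (intro second_isomorphism_grp.intro second_isomorphism_grp_axioms.intro normal_axioms)
  show ?thesis by (rule normal_set_mult_subgroup)
qed

lemma (in normal) normal_set_mult:
  assumes "K \<lhd> G"
  shows "(H <#> K) \<lhd> G"
proof -
  interpret K: normal K G by fact
  have *: "x \<otimes> (h \<otimes> k) \<otimes> inv x = (x \<otimes> h \<otimes> inv x) \<otimes> (x \<otimes> k \<otimes> inv x)"
    if "x \<in> carrier G" "h \<in> H" "k \<in> K" for x h k
    using that subset K.subset by (simp add: m_assoc inv_solve_left subsetD)
  show ?thesis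
    unfolding normal_inv_iff
  proof (intro conjI ballI)
    show "subgroup (H <#> K) G" by (rule subgroup_set_mult) (rule K.subgroup_axioms)
    fix x y assume "x \<in> carrier G" "y \<in> H <#> K"
    then show "x \<otimes> y \<otimes> inv x \<in> H <#> K"
      unfolding set_mult_def using * inv_op_closed2 K.inv_op_closed2 by fastforce
  qed
qed

lemma (in normal) subset_set_mult:
  assumes "subgroup S G"
  shows "H \<subseteq> H <#> S" "S \<subseteq> H <#> S"
proof -
  show "H \<subseteq> H <#> S"
  proof
    fix h assume "h \<in> H"
    then show "h \<in> H <#> S"
      unfolding set_mult_def using subset subgroup.one_closed[OF assms]
      by (intro UN_I[of h] UN_I[of \<one>]) auto
  qed
  show "S \<subseteq> H <#> S"
  proof
    fix s assume "s \<in> S"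
    then show "s \<in> H <#> S"
      unfolding set_mult_def using subgroup.mem_carrier[OF assms] one_closed
      by (intro UN_I[of \<one>] UN_I[of s]) auto
  qed
qed

lemma (in normal) card_set_mult:
  assumes S: "subgroup S G" and fin: "finite (carrier G)"
  shows "card (H <#> S) * card (S \<inter> H) = card S * card H"
proof -
  interpret q: group_hom G "G Mod H" "\<lambda>x. H #> x" by (rule quotient_hom)
  have sub: "subgroup (H <#> S) G" using S by (rule subgroup_set_mult)
  have f: "finite S" "finite (H <#> S)"
    using S sub fin by (auto dest: subgroup.subset finite_subset)
  have im: "(\<lambda>x. H #> x) ` (H <#> S) = (\<lambda>x. H #> x) ` S"
  proof
    show "(\<lambda>x. H #> x) ` (H <#> S) \<subseteq> (\<lambda>x. H #> x) ` S"
    proof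
      fix c assume "c \<in> (\<lambda>x. H #> x) ` (H <#> S)"
      then obtain x where x: "x \<in> H <#> S" "c = H #> x" by auto
      then have "x \<in> carrier G" using subgroup.mem_carrier[OF sub] by blast
      then show "c \<in> (\<lambda>x. H #> x) ` S" using x mem_set_mult_iff[OF S] by auto
    qed
    show "(\<lambda>x. H #> x) ` S \<subseteq> (\<lambda>x. H #> x) ` (H <#> S)"
      by (rule image_mono) (rule subset_set_mult(2)[OF S])
  qed
  have ker: "{x \<in> T. H #> x = H} = T \<inter> H" if "subgroup T G" for T
    using coset_eq_self_iff subgroup.mem_carrier[OF that] by blast
  have ker': "{x \<in> H <#> S. H #> x = H} = H"
    unfolding ker[OF sub] using subset_set_mult(1)[OF S] by (rule Int_absorb1)
  have 1: "card S = card ((\<lambda>x. H #> x) ` S) * card (S \<inter> H)"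
    using q.card_image_kernel[OF S f(1)] unfolding one_FactGroup ker[OF S] .
  have 2: "card (H <#> S) = card ((\<lambda>x. H #> x) ` S) * card H"
    using q.card_image_kernel[OF sub f(2)] unfolding one_FactGroup ker' im .
  show ?thesis by (subst 1, subst 2) (simp only: mult_ac)
qed

text \<open>This is Sylow's existence theorem in \<open>G Mod H\<close>, pulled back to \<open>G\<close>. The power \<open>p ^ a\<close> need not be the
  largest one dividing the index, so the lemma yields subgroups of prime order over \<open>H\<close> as
  well as subgroups of prime index above \<open>H\<close>.\<close>

lemma (in normal) exists_intermediate_subgroup:
  assumes fin: "finite (carrier G)" and p: "prime p" and o: "order G = p ^ a * m * card H"
  shows "\<exists>S. subgroup S G \<and> H \<subseteq> S \<and> card S = p ^ a * card H"
proof -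
  interpret q: group_hom G "G Mod H" "\<lambda>x. H #> x" by (rule quotient_hom)
  have Hpos: "card H > 0" using fin card_subgroup_pos subgroup_axioms by auto
  have "card (rcosets H) * card H = order G" by (rule lagrange) (rule subgroup_axioms)
  then have "order (G Mod H) = p ^ a * m" using o Hpos by (simp add: order_def FactGroup_def)
  moreover have "finite (carrier (G Mod H))"
    using fin by (simp add: carrier_FactGroup)
  ultimately obtain T where T: "subgroup T (G Mod H)" "card T = p ^ a"
    using sylow_thm[OF p q.H.is_group] by blast
  define S where "S = {x \<in> carrier G. H #> x \<in> T}"
  have one: "H \<in> T" using T(1) subgroup.one_closed by fastforce
  have S: "subgroup S G"
  proof (rule subgroupI)
    show "S \<subseteq> carrier G" by (auto simp: S_def)
    have "\<one> \<in> S" unfolding S_def using q.hom_one one by simp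
    then show "S \<noteq> {}" by auto
    show "inv x \<in> S" if "x \<in> S" for x
      using that subgroup.m_inv_closed[OF T(1)] q.hom_inv[of x] by (auto simp: S_def)
    show "x \<otimes> y \<in> S" if "x \<in> S" "y \<in> S" for x y
      using that subgroup.m_closed[OF T(1)] q.hom_mult[of x y] by (auto simp: S_def)
  qed
  have HS: "H \<subseteq> S"
  proof
    fix x assume x: "x \<in> H"
    then have "H #> x = H" using coset_eq_self_iff subset by blast
    then show "x \<in> S" using one subset x by (auto simp: S_def)
  qed
  have ker: "{x \<in> S. H #> x = H} = H"
    using HS coset_eq_self_iff subgroup.mem_carrier[OF S] by auto
  have im: "(\<lambda>x. H #> x) ` S = T"
    using subgroup.subset[OF T(1)] by (auto simp: S_def carrier_FactGroup)
  have "finite S" using fin by (simp add: S_def)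
  from q.card_image_kernel[OF S this] have "card S = p ^ a * card H"
    unfolding one_FactGroup ker im T(2) .
  then show ?thesis using S HS by blast
qed

lemma (in group) exists_subgroup_between:
  assumes fin: "finite (carrier G)" and p: "prime p" and B: "subgroup B G"
    and A: "A \<lhd> (G\<lparr>carrier := B\<rparr>)" and o: "card B = p ^ a * m * card A"
  shows "\<exists>S. subgroup S G \<and> A \<subseteq> S \<and> S \<subseteq> B \<and> card S = p ^ a * card A"
proof -
  interpret n: normal A "G\<lparr>carrier := B\<rparr>" by fact
  have "finite B" using fin B subgroup.subset finite_subset by metis
  then obtain S where "subgroup S (G\<lparr>carrier := B\<rparr>)" "A \<subseteq> S" "card S = p ^ a * card A"
    using n.exists_intermediate_subgroup[OF _ p, of a m] o by (auto simp: order_def)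
  then show ?thesis using incl_subgroup[OF B] subgroup.subset by fastforce
qed

lemma (in normal) power_index_mem:
  assumes fin: "finite (carrier G)" and x: "x \<in> carrier G" and o: "order G = n * card H"
  shows "x [^] n \<in> H"
proof -
  interpret q: group_hom G "G Mod H" "\<lambda>x. H #> x" by (rule quotient_hom)
  have Hpos: "card H > 0" using fin card_subgroup_pos subgroup_axioms by auto
  have "card (rcosets H) * card H = order G" by (rule lagrange) (rule subgroup_axioms)
  then have oq: "order (G Mod H) = n" using o Hpos by (simp add: order_def FactGroup_def)
  have "(H #> x) [^]\<^bsub>G Mod H\<^esub> n = \<one>\<^bsub>G Mod H\<^esub>"
    using q.H.pow_order_eq_1[OF q.hom_closed[OF x]] oq by simp
  then have "H #> x [^] n = H" unfolding q.hom_nat_pow[OF x, symmetric] one_FactGroup .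
  then show ?thesis using coset_eq_self_iff x by simp
qed

text \<open>The order of the coset of \<open>x\<close> divides both \<open>m\<close> and the index of \<open>H\<close>.\<close>

lemma (in normal) coprime_power_mem:
  assumes fin: "finite (carrier G)" and x: "x \<in> carrier G" and xm: "x [^] (m::nat) \<in> H"
    and o: "order G = n * card H" and c: "coprime m n"
  shows "x \<in> H"
proof -
  have "H #> x = H"
  proof -
    interpret q: group_hom G "G Mod H" "\<lambda>x. H #> x" by (rule quotient_hom)
    have hx: "H #> x \<in> carrier (G Mod H)" using x by (rule q.hom_closed)
    have dvd: "q.H.ord (H #> x) dvd k" if "x [^] k \<in> H" for k :: nat
    proof -
      have "H #> x [^] k = H" using coset_eq_self_iff that x by simp
      then have "(H #> x) [^]\<^bsub>G Mod H\<^esub> k = \<one>\<^bsub>G Mod H\<^esub>"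
        unfolding q.hom_nat_pow[OF x] one_FactGroup .
      then show ?thesis by (rule iffD1[OF q.H.pow_eq_id[OF hx]])
    qed
    have "q.H.ord (H #> x) = 1"
      by (rule coprime_common_divisor_nat[OF c dvd[OF xm] dvd[OF power_index_mem[OF fin x o]]])
    then have "H #> x = \<one>\<^bsub>G Mod H\<^esub>" by (rule iffD1[OF q.H.ord_eq_1[OF hx]])
    then show ?thesis unfolding one_FactGroup .
  qed
  then show ?thesis by (rule iffD1[OF coset_eq_self_iff[OF x]])
qed

section \<open>Permutations of prime power order on few points\<close>

text \<open>A moved point would lie in a cycle whose length is a positive power of \<open>p\<close>, hence
  at least \<open>p\<close>. Together with the fixed point this would make more than \<open>p\<close> points.\<close>

lemma fixes_all_if_fixes_one:
  fixes p :: nat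
  assumes p: "prime p" and fin: "finite S" and card: "card S \<le> p" and s0: "s0 \<in> S" "f s0 = s0"
    and cl: "\<And>s. s \<in> S \<Longrightarrow> f s \<in> S" and per: "\<And>s. s \<in> S \<Longrightarrow> (f ^^ (p ^ k)) s = s"
    and s: "s \<in> S"
  shows "f s = s"
proof (rule ccontr)
  assume ne: "f s \<noteq> s"
  have it: "(f ^^ n) s \<in> S" for n using s cl by (induction n) auto
  have iter_mult: "(f ^^ (a * n)) y = y" if "(f ^^ n) y = y" for a n y
    using that by (induction a) (auto simp: funpow_add)
  have fixp: False if h: "(f ^^ d) ((f ^^ i) s) = (f ^^ i) s" "0 < d" "d < p" for d i
  proof -
    define y where "y = (f ^^ i) s"
    have "coprime d (p ^ k)" using h p 
      by (metis coprime_commute coprime_power_right_iff dvd_imp_le not_le prime_imp_coprime)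
    \<comment> \<open>Since \<open>d\<close> is prime to \<open>p ^ k\<close>, fixed points of the \<open>d\<close>th iterate are fixed by \<open>f\<close>.\<close>
    then have "\<exists>a b. d * a = p ^ k * b + 1"
      using h bezout_nat[of d "p ^ k"] by auto
    then obtain a b where ab: "d * a = p ^ k * b + 1" by blast
    have "(f ^^ (a * d)) y = y" using h(1) iter_mult unfolding y_def by blast
    moreover have "(f ^^ (b * p ^ k)) y = y" using per it iter_mult unfolding y_def by blast
    then have "(f ^^ (1 + b * p ^ k)) y = f y" unfolding funpow_add by simp
    ultimately have fy: "f y = y" using ab by (simp add: mult.commute)
    have p0: "p ^ k > 0" using p by (simp add: prime_gt_0_nat)
    \<comment> \<open>After \<open>j\<close> further applications of \<open>f\<close>, \<open>y\<close> has returned to \<open>s\<close>, so \<open>s = y\<close> is itself fixed.\<close>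
    define j where "j = i * p ^ k - i"
    have j: "j + i = i * p ^ k" unfolding j_def
      using mult_le_mono2[of 1 "p ^ k" i] p0 by linarith
    have "(f ^^ j) y = y" using fy by (induction j) auto
    moreover have "(f ^^ j) y = (f ^^ (i * p ^ k)) s" unfolding y_def j[symmetric] by (simp add: funpow_add)
    moreover have "\<dots> = s" using per s iter_mult by blast
    ultimately have "y = s" by simp
    then show False using ne fy by simp
  qed
  have inj: "inj_on (\<lambda>i. (f ^^ i) s) {..<p}"
  proof (rule linorder_inj_onI)
    fix i j assume ij: "i < j" "i \<in> {..<p}" "j \<in> {..<p}"
    have "(f ^^ j) s = (f ^^ (j - i)) ((f ^^ i) s)"
      using ij funpow_add[of "j - i" i f] by simp
    moreover have "0 < j - i" "j - i < p" using ij by auto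
    ultimately show "(f ^^ i) s \<noteq> (f ^^ j) s" using fixp[of "j - i" i] by metis
  qed auto
  have "s0 \<notin> (\<lambda>i. (f ^^ i) s) ` {..<p}"
  proof
    assume "s0 \<in> (\<lambda>i. (f ^^ i) s) ` {..<p}"
    then obtain i where "(f ^^ i) s = s0" by auto
    then have "(f ^^ 1) ((f ^^ i) s) = (f ^^ i) s" using s0 by simp
    then show False using fixp[of 1 i] prime_gt_1_nat[OF p] by simp
  qed
  then have c: "card (insert s0 ((\<lambda>i. (f ^^ i) s) ` {..<p})) = Suc p"
    using card_image[OF inj] by simp
  have "insert s0 ((\<lambda>i. (f ^^ i) s) ` {..<p}) \<subseteq> S" using s0 it by auto
  from card_mono[OF fin this] show False unfolding c using card by simp
qed

text \<open>The element \<open>u\<close> permutes the at most \<open>p\<close> cosets of \<open>M\<close> in \<open>K\<close> by right multiplication and fixes the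
  coset \<open>M\<close>. The order of this permutation is a power of \<open>p\<close> because \<open>L\<close> acts trivially. So \<open>u\<close> fixes all
  cosets. This gives the normality of subgroups of index \<open>p\<close> in \<open>p\<close>-groups and, for the largest prime divisor \<open>p\<close> of a group order,
  the normality of Sylow \<open>p\<close>-subgroups.\<close>

lemma (in group) conj_mem_if_small_index:
  assumes fin: "finite (carrier G)" and p: "prime p"
    and M: "subgroup M G" and K: "subgroup K G" "M \<subseteq> K" "card K \<le> p * card M"
    and L: "L \<subseteq> M" "\<And>x l. x \<in> K \<Longrightarrow> l \<in> L \<Longrightarrow> x \<otimes> l \<otimes> inv x \<in> L"
    and u: "u \<in> M" "u [^] (p ^ k :: nat) \<in> L" and x: "x \<in> K"
  shows "x \<otimes> u \<otimes> inv x \<in> M"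
proof -
  note [simp] = subgroup.mem_carrier[OF M] subgroup.mem_carrier[OF K(1)] subgroup.subset[OF M]
  define S where "S = (\<lambda>x. M #> x) ` K"
  have uK: "u \<in> K" using u K by auto
  have uc: "u \<in> carrier G" using u M by simp
  have "S = rcosets\<^bsub>G\<lparr>carrier := K\<rparr>\<^esub> M" by (auto simp: S_def RCOSETS_def)
  then have "card S * card M = card K"
    using subgroup_index_mult_card[OF M K(1,2)] by (simp add: subgroup_index_def)
  then have "card S * card M \<le> p * card M" using K(3) by simp
  then have cS: "card S \<le> p" using card_subgroup_pos[OF M fin] by simp
  have fS: "finite S" unfolding S_def using finite_subset[OF subgroup.subset[OF K(1)] fin] by (rule finite_imageI)
  define f where "f c = c #> u" for c
  have fM: "f (M #> y) = M #> (y \<otimes> u)" if "y \<in> K" for y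
    using that u by (simp add: f_def coset_mult_assoc)
  have fn: "(f ^^ n) (M #> y) = M #> (y \<otimes> u [^] n)" if "y \<in> K" for y and n :: nat
  proof (induction n)
    case (Suc n)
    have "y \<otimes> u [^] n \<in> K" using that uK K
      by (induction n) (auto simp: subgroup.m_closed simp flip: m_assoc)
    then have "f (M #> (y \<otimes> u [^] n)) = M #> (y \<otimes> u [^] n \<otimes> u)" by (rule fM)
    then show ?case using Suc that uK by (simp add: m_assoc)
  qed (use that in simp)
  have "f (M #> x) = M #> x"
  proof (rule fixes_all_if_fixes_one[OF p fS cS, of M])
    show "M \<in> S" unfolding S_def using subgroup.one_closed[OF K(1)] by (auto intro!: image_eqI[of _ _ \<one>])
    show "f M = M" unfolding f_def using u coset_join2[OF uc M] by simp
    show "f s \<in> S" if "s \<in> S" for s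
      using that uK fM K by (auto simp: S_def subgroup.m_closed)
    show "(f ^^ (p ^ k)) s = s" if s: "s \<in> S" for s
    proof -
      obtain y where y: "y \<in> K" "s = M #> y" using s by (auto simp: S_def)
      define l where "l = y \<otimes> u [^] (p ^ k) \<otimes> inv y"
      have l: "l \<in> M" using L u y unfolding l_def by blast
      have "y \<otimes> u [^] (p ^ k) = l \<otimes> y" using y uc by (simp add: l_def m_assoc)
      then have "M #> (y \<otimes> u [^] (p ^ k)) = (M #> l) #> y" using l y by (simp add: coset_mult_assoc)
      also have "M #> l = M" using coset_join2 l M by simp
      finally show ?thesis using fn y by simp
    qed
    show "M #> x \<in> S" using x by (simp add: S_def)
  qed
  then have "M #> (x \<otimes> u) = M #> x" using fM x by simp
  then have "x \<otimes> u \<in> M #> x" using rcos_self[OF _ M] x uK uc by (metis K(1) m_closed subgroup.mem_carrier)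
  then show ?thesis using subgroup.rcos_module[OF M is_group] x uc by simp
qed

section \<open>Chains of subgroups\<close>

definition good_prime :: "nat \<Rightarrow> nat \<Rightarrow> bool" where
  "good_prime t p \<longleftrightarrow> prime p \<and> (\<forall>q. prime q \<longrightarrow> \<not> q ^ (t + 1) dvd p - 1)"

text \<open>Indices are expressed by products of cardinalities, so that they can be compared across the
  product formula \<open>card_set_mult\<close> without division.\<close>

definition KP_step :: "nat \<Rightarrow> ('a, 'b) monoid_scheme \<Rightarrow> 'a set \<Rightarrow> 'a set \<Rightarrow> bool" where
  "KP_step t G A B \<longleftrightarrow> subgroup A G \<and> subgroup B G \<and> A \<subseteq> B \<and>
     ((\<forall>x\<in>B. \<forall>a\<in>A. x \<otimes>\<^bsub>G\<^esub> a \<otimes>\<^bsub>G\<^esub> inv\<^bsub>G\<^esub> x \<in> A) \<or> (\<exists>p. good_prime t p \<and> card B = p * card A))"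

definition prime_step :: "('a, 'b) monoid_scheme \<Rightarrow> 'a set \<Rightarrow> 'a set \<Rightarrow> bool" where
  "prime_step G A B \<longleftrightarrow> A \<lhd> G \<and> B \<lhd> G \<and> A \<subseteq> B \<and> (\<exists>p. prime p \<and> card B = p * card A)"

text \<open>This says that all commutators of \<open>G\<close> with \<open>B\<close> lie in \<open>A\<close>, in a form free of inverses that
  passes to intersections and images unchanged.\<close>

definition central_over :: "('a, 'b) monoid_scheme \<Rightarrow> 'a set \<Rightarrow> 'a set \<Rightarrow> bool" where
  "central_over G A B \<longleftrightarrow> (\<forall>x\<in>carrier G. \<forall>b\<in>B. \<exists>a\<in>A. x \<otimes>\<^bsub>G\<^esub> b = a \<otimes>\<^bsub>G\<^esub> b \<otimes>\<^bsub>G\<^esub> x)"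

text \<open>A central step may have any index. This lets a whole abelian quotient of \<open>G\<close> be
  one step; \<open>U0_step_refine\<close> recovers steps of prime index where supersolubility requires them.\<close>

definition U0_step :: "nat \<Rightarrow> ('a, 'b) monoid_scheme \<Rightarrow> 'a set \<Rightarrow> 'a set \<Rightarrow> bool" where
  "U0_step t G A B \<longleftrightarrow> A \<lhd> G \<and> B \<lhd> G \<and> A \<subseteq> B \<and>
     (central_over G A B \<or> (\<exists>p. good_prime t p \<and> card B = p * card A))"

lemma chain_iff_rtranclp:
  "(\<exists>C n. C 0 = a \<and> C n = b \<and> (\<forall>i\<le>n. P (C i)) \<and> (\<forall>i<n::nat. Q (C i) (C (Suc i)))) \<longleftrightarrow>
     P a \<and> (\<lambda>x y. P x \<and> P y \<and> Q x y)\<^sup>*\<^sup>* a b" (is "?L \<longleftrightarrow> ?R")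
proof
  assume ?L
  then obtain C n where C: "C 0 = a" "C n = b" "\<forall>i\<le>n. P (C i)" "\<forall>i<n. Q (C i) (C (Suc i))"
    by auto
  then have "\<forall>i<n. P (C i) \<and> P (C (Suc i)) \<and> Q (C i) (C (Suc i))" by auto
  then have "((\<lambda>x y. P x \<and> P y \<and> Q x y) ^^ n) a b" unfolding relpowp_fun_conv using C by blast
  then show ?R using C by (auto simp: rtranclp_power)
next
  assume R: ?R
  then obtain n where "((\<lambda>x y. P x \<and> P y \<and> Q x y) ^^ n) a b" by (auto simp: rtranclp_power)
  then obtain C where C: "C 0 = a" "C n = b" "\<forall>i<n. P (C i) \<and> P (C (Suc i)) \<and> Q (C i) (C (Suc i))"
    unfolding relpowp_fun_conv by blast
  have "P (C i)" if "i \<le> n" for i using that C R by (cases i) auto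
  then show ?L using C by (intro exI[of _ C] exI[of _ n]) auto
qed

lemma (in group) KP_subnormal_iff:
  assumes fin: "finite (carrier G)"
  shows "KP_subnormal t H G \<longleftrightarrow> subgroup H G \<and> (KP_step t G)\<^sup>*\<^sup>* H (carrier G)"
proof -
  define Q where "Q A B \<longleftrightarrow> A \<subseteq> B \<and> (A \<lhd> (G\<lparr>carrier := B\<rparr>) \<or>
         (\<exists>p. prime p \<and> subgroup_index G B A = p \<and>
              (\<forall>q. prime q \<longrightarrow> \<not> q ^ (t + 1) dvd (p - 1))))" for A B
  have "subgroup A G \<and> subgroup B G \<and> Q A B \<longleftrightarrow> KP_step t G A B" for A B
  proof -
    have "good_prime t (subgroup_index G B A) \<longleftrightarrow> (\<exists>p. good_prime t p \<and> card B = p * card A)"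
      if "subgroup A G" "subgroup B G" "A \<subseteq> B"
      using subgroup_index_mult_card[OF that] card_subgroup_pos[OF that(1) fin]
      by (metis mult_cancel2 not_gr_zero)
    then show ?thesis
      unfolding KP_step_def Q_def good_prime_def using normal_subgroup_iff by blast
  qed
  then have "(\<lambda>A B. subgroup A G \<and> subgroup B G \<and> Q A B) = KP_step t G" by (intro ext)
  then show ?thesis
    unfolding KP_subnormal_def using chain_iff_rtranclp[of H "carrier G" "\<lambda>A. subgroup A G" Q]
    unfolding Q_def by simp
qed

section \<open>Supersoluble groups and normal series with prime indices\<close>

text \<open>A group of prime order is generated by each of its nontrivial elements. The conclusion is stated in \<open>G\<close>,
  so that it can be used with cosets in any overgroup of \<open>B\<close>.\<close>

lemma (in group) prime_index_powers:
  assumes fin: "finite (carrier G)" and B: "subgroup B G" and A: "A \<lhd> (G\<lparr>carrier := B\<rparr>)"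
    and p: "prime p" "card B = p * card A" and b: "b \<in> B" "b \<notin> A" and y: "y \<in> B"
  shows "\<exists>k::nat. \<exists>a\<in>A. y = a \<otimes> b [^] k"
proof -
  interpret n: normal A "G\<lparr>carrier := B\<rparr>" by fact
  interpret q: group_hom "G\<lparr>carrier := B\<rparr>" "G\<lparr>carrier := B\<rparr> Mod A" "\<lambda>x. A #>\<^bsub>G\<lparr>carrier := B\<rparr>\<^esub> x"
    by (rule n.quotient_hom)
  let ?Q = "G\<lparr>carrier := B\<rparr> Mod A"
  let ?b = "A #>\<^bsub>G\<lparr>carrier := B\<rparr>\<^esub> b"
  have AG: "subgroup A G" using n.subgroup_axioms incl_subgroup[OF B] by blast
  have finB: "finite B" using fin B subgroup.subset finite_subset by metis
  have "subgroup_index G B A * card A = card B"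
    using n.subset by (intro subgroup_index_mult_card AG B) simp
  then have "subgroup_index G B A = p" using p card_subgroup_pos[OF AG fin] by simp
  then have o: "order ?Q = p" by (simp add: subgroup_index_def order_def FactGroup_def)
  have finQ: "finite (carrier ?Q)" using finB by (simp add: carrier_FactGroup)
  have bQ: "?b \<in> carrier ?Q" using b by (intro q.hom_closed) simp
  have "q.H.ord ?b dvd p" using q.H.ord_dvd_group_order[OF bQ] o by simp
  moreover have "q.H.ord ?b \<noteq> 1"
  proof
    assume "q.H.ord ?b = 1"
    then have "?b = \<one>\<^bsub>?Q\<^esub>" by (rule iffD1[OF q.H.ord_eq_1[OF bQ]])
    then show False using n.coset_eq_self_iff[of b] b by simp
  qed
  ultimately have ord: "q.H.ord ?b = p" using p prime_nat_iff by blast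
  have "inj_on (\<lambda>x. ?b [^]\<^bsub>?Q\<^esub> x) {0..q.H.ord ?b - 1}" by (rule q.H.ord_inj[OF bQ])
  then have "card ((\<lambda>x::nat. ?b [^]\<^bsub>?Q\<^esub> x) ` {0..q.H.ord ?b - 1}) = p"
    using ord p by (simp add: card_image prime_gt_0_nat)
  then have "(\<lambda>x::nat. ?b [^]\<^bsub>?Q\<^esub> x) ` {0..q.H.ord ?b - 1} = carrier ?Q"
    using o bQ by (intro card_subset_eq finQ) (auto simp: order_def)
  moreover have "A #>\<^bsub>G\<lparr>carrier := B\<rparr>\<^esub> y \<in> carrier ?Q" using y by (intro q.hom_closed) simp
  ultimately obtain k :: nat where k: "A #>\<^bsub>G\<lparr>carrier := B\<rparr>\<^esub> y = ?b [^]\<^bsub>?Q\<^esub> k"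
    by (metis (lifting) imageE)
  have bB: "b \<in> carrier (G\<lparr>carrier := B\<rparr>)" using b by simp
  have pc: "b [^]\<^bsub>G\<lparr>carrier := B\<rparr>\<^esub> k = b [^] k" by (rule nat_pow_consistent[symmetric])
  have bk: "b [^] k \<in> B"
    using monoid.nat_pow_closed[OF n.is_monoid bB, of k] pc by simp
  have "A #>\<^bsub>G\<lparr>carrier := B\<rparr>\<^esub> y = A #>\<^bsub>G\<lparr>carrier := B\<rparr>\<^esub> (b [^] k)"
    using k n.FactGroup_pow[OF bB, of k] pc by simp
  then have "y \<otimes> inv (b [^] k) \<in> A"
    using n.coset_eq_iff[of y "b [^] k"] y bk m_inv_consistent[OF B bk] by simp
  moreover have "y = (y \<otimes> inv (b [^] k)) \<otimes> b [^] k"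
    using y bk B by (simp add: m_assoc subgroup.mem_carrier)
  ultimately show ?thesis by blast
qed

lemma (in group) prime_step_imp_cyclic:
  assumes fin: "finite (carrier G)" and s: "prime_step G A B"
  shows "cyclic_group ((G\<lparr>carrier := B\<rparr>) Mod A)"
proof -
  obtain p where AB: "A \<lhd> G" "B \<lhd> G" "A \<subseteq> B" and p: "prime p" "card B = p * card A"
    using s by (auto simp: prime_step_def)
  have B: "subgroup B G" using AB by (simp add: normal_imp_subgroup)
  have A: "A \<lhd> (G\<lparr>carrier := B\<rparr>)" using AB B by (intro normal_in_subgroup)
  interpret n: normal A "G\<lparr>carrier := B\<rparr>" by fact
  let ?Q = "G\<lparr>carrier := B\<rparr> Mod A"
  interpret q: group_hom "G\<lparr>carrier := B\<rparr>" ?Q "\<lambda>x. A #>\<^bsub>G\<lparr>carrier := B\<rparr>\<^esub> x"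
    by (rule n.quotient_hom)
  have "card A < card B"
    using p card_subgroup_pos[OF normal_imp_subgroup[OF AB(1)] fin] prime_gt_1_nat[of p] by simp
  then obtain b where b: "b \<in> B" "b \<notin> A"
    using AB(3) by (metis less_irrefl subsetI subset_antisym)
  let ?b = "A #>\<^bsub>G\<lparr>carrier := B\<rparr>\<^esub> b"
  have bB: "b \<in> carrier (G\<lparr>carrier := B\<rparr>)" using b by simp
  have bQ: "?b \<in> carrier ?Q" using bB by (rule q.hom_closed)
  have "c \<in> range (\<lambda>n::int. ?b [^]\<^bsub>?Q\<^esub> n)" if c: "c \<in> carrier ?Q" for c
  proof -
    obtain y where y: "y \<in> B" "c = A #>\<^bsub>G\<lparr>carrier := B\<rparr>\<^esub> y" using c by (auto simp: carrier_FactGroup)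
    obtain k :: nat and a where a: "a \<in> A" "y = a \<otimes> b [^] k"
      using prime_index_powers[OF fin B A p b y(1)] by blast
    have ac: "a \<in> B" using a AB by auto
    have pc: "b [^]\<^bsub>G\<lparr>carrier := B\<rparr>\<^esub> k = b [^] k" by (rule nat_pow_consistent[symmetric])
    have bk: "b [^] k \<in> B"
      using monoid.nat_pow_closed[OF n.is_monoid bB, of k] pc by simp
    have "y \<otimes> inv (b [^] k) = a"
      unfolding a(2) using ac bk B by (simp add: m_assoc subgroup.mem_carrier)
    then have "c = A #>\<^bsub>G\<lparr>carrier := B\<rparr>\<^esub> (b [^] k)"
      using n.coset_eq_iff[of y "b [^] k"] y bk m_inv_consistent[OF B bk] a by simp
    also have "\<dots> = ?b [^]\<^bsub>?Q\<^esub> (int k)"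
      using n.FactGroup_pow[OF bB, of k] pc by (simp add: int_pow_int)
    finally show ?thesis by blast
  qed
  moreover have "?b [^]\<^bsub>?Q\<^esub> n \<in> carrier ?Q" for n :: int
    by (rule q.H.int_pow_closed[OF bQ])
  ultimately have "carrier ?Q = range (\<lambda>n::int. ?b [^]\<^bsub>?Q\<^esub> n)" by blast
  then show ?thesis unfolding q.H.cyclic_group using bQ by blast
qed

text \<open>Sylow's theorem gives a subgroup of prime order over \<open>A\<close>. It is
  normal by hypothesis, so it can serve as the first step, and the rest follows by induction.\<close>

lemma (in group) prime_steps_between:
  assumes fin: "finite (carrier G)" and A: "A \<lhd> G" and B: "B \<lhd> G" and AB: "A \<subseteq> B"
    and nrm: "\<And>S. subgroup S G \<Longrightarrow> A \<subseteq> S \<Longrightarrow> S \<subseteq> B \<Longrightarrow> S \<lhd> G"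
  shows "(prime_step G)\<^sup>*\<^sup>* A B"
  using A AB nrm
proof (induction "card B - card A" arbitrary: A rule: less_induct)
  case less
  have sub: "subgroup A G" "subgroup B G" using less.prems(1) B by (auto simp: normal_imp_subgroup)
  have finB: "finite B" using fin sub subgroup.subset finite_subset by metis
  show ?case
  proof (cases "A = B")
    case False
    then have lt: "card A < card B" using less.prems(2) finB by (simp add: psubset_card_mono psubsetI)
    obtain n where n: "card B = n * card A"
      using card_subgroup_dvd[OF sub less.prems(2)] by (metis dvd_def mult.commute)
    then have "n \<noteq> 1" using lt by auto
    then obtain p where p: "prime p" "p dvd n" using prime_factor_nat by blast
    then obtain m where "n = p * m" by auto
    then have o: "card B = p ^ 1 * m * card A" using n by simp
    obtain S where S: "subgroup S G" "A \<subseteq> S" "S \<subseteq> B" "card S = p ^ 1 * card A"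
      using exists_subgroup_between[OF fin p(1) sub(2) normal_in_subgroup[OF sub(2) less.prems(1,2)] o]
      by blast
    have SG: "S \<lhd> G" using S less.prems(3) by blast
    have st: "prime_step G A S" unfolding prime_step_def using less.prems(1) SG S p(1) by auto
    have "card A < card S"
      using S(4) card_subgroup_pos[OF sub(1) fin] prime_gt_1_nat[OF p(1)] by simp
    then have dec: "card B - card S < card B - card A" using lt by linarith
    have "(prime_step G)\<^sup>*\<^sup>* S B"
    proof (rule less.hyps[OF dec SG S(3)])
      show "T \<lhd> G" if "subgroup T G" "S \<subseteq> T" "T \<subseteq> B" for T
        using that S(2) less.prems(3)[of T] by blast
    qed
    with st show ?thesis by (rule converse_rtranclp_into_rtranclp)
  qed simp
qed

lemma (in group) conj_int_pow:
  assumes "x \<in> carrier G" "y \<in> carrier G"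
  shows "(x \<otimes> y \<otimes> inv x) [^] (k::int) = x \<otimes> y [^] k \<otimes> inv x"
proof -
  have "(\<lambda>y. x \<otimes> y \<otimes> inv x) \<in> hom G G"
    using assms by (auto intro!: homI simp: m_assoc inv_solve_left)
  from hom_int_pow[OF this assms(2) is_group is_group] show ?thesis by simp
qed

lemma (in normal) coset_conj_eq:
  assumes c: "x \<in> carrier G" "y \<in> carrier G" "z \<in> carrier G" and e: "H #> y = H #> z"
  shows "H #> (x \<otimes> y \<otimes> inv x) = H #> (x \<otimes> z \<otimes> inv x)"
proof -
  interpret q: group_hom G "G Mod H" "\<lambda>x. H #> x" by (rule quotient_hom)
  show ?thesis using c e by (metis inv_closed m_closed q.hom_mult)
qed

lemma (in normal) coset_int_pow_eq:
  assumes c: "y \<in> carrier G" "z \<in> carrier G" and e: "H #> y = H #> z"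
  shows "H #> y [^] (k::int) = H #> z [^] k"
  using FactGroup_int_pow[OF c(1), of k] FactGroup_int_pow[OF c(2), of k] e by simp

text \<open>Conjugation acts on a cyclic normal section \<open>B/A\<close> as a power map, so it maps every subgroup between
  \<open>A\<close> and \<open>B\<close> into itself.\<close>

lemma (in group) prime_steps_of_cyclic:
  assumes fin: "finite (carrier G)" and A: "A \<lhd> G" and B: "B \<lhd> G" and AB: "A \<subseteq> B"
    and cyc: "cyclic_group ((G\<lparr>carrier := B\<rparr>) Mod A)"
  shows "(prime_step G)\<^sup>*\<^sup>* A B"
proof (rule prime_steps_between[OF fin A B AB])
  fix S assume S: "subgroup S G" "A \<subseteq> S" "S \<subseteq> B"
  have subB: "subgroup B G" using B by (rule normal_imp_subgroup)
  have AnB: "A \<lhd> (G\<lparr>carrier := B\<rparr>)" using A subB AB by (intro normal_in_subgroup)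
  interpret n: normal A "G\<lparr>carrier := B\<rparr>" by fact
  interpret N: normal A G by fact
  interpret B: normal B G by fact
  let ?Q = "G\<lparr>carrier := B\<rparr> Mod A"
  interpret q: group_hom "G\<lparr>carrier := B\<rparr>" ?Q "\<lambda>x. A #>\<^bsub>G\<lparr>carrier := B\<rparr>\<^esub> x"
    by (rule n.quotient_hom)
  obtain c where c: "c \<in> carrier ?Q" "carrier ?Q = range (\<lambda>n::int. c [^]\<^bsub>?Q\<^esub> n)"
    using cyc unfolding q.H.cyclic_group by blast
  from c(1) obtain b where b: "b \<in> B" "c = A #> b" by (auto simp: carrier_FactGroup)
  have gen: "\<exists>k::int. A #> y = A #> b [^] k" if y: "y \<in> B" for y
  proof -
    have "A #> y \<in> carrier ?Q" using y by (auto simp: carrier_FactGroup)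
    then obtain k :: int where "A #> y = c [^]\<^bsub>?Q\<^esub> k" using c by (metis rangeE)
    also have "\<dots> = A #> b [^] k"
      using n.FactGroup_int_pow[of b k] b int_pow_consistent[OF subB b(1), of k] by simp
    finally show ?thesis by blast
  qed
  show "S \<lhd> G"
    unfolding normal_inv_iff
  proof (intro conjI ballI)
    show "subgroup S G" by fact
    fix x s assume x: "x \<in> carrier G" and s: "s \<in> S"
    have bc: "b \<in> carrier G" and sc: "s \<in> carrier G"
      using b s S subgroup.mem_carrier[OF subB] by auto
    obtain k :: int where k: "A #> s = A #> b [^] k" using gen s S by blast
    obtain m :: int where m: "A #> (x \<otimes> b \<otimes> inv x) = A #> b [^] m"
      using gen B.inv_op_closed2[OF x b(1)] by blast
    have "A #> (x \<otimes> s \<otimes> inv x) = A #> (x \<otimes> b [^] k \<otimes> inv x)"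
      using x sc bc k by (intro N.coset_conj_eq) auto
    also have "\<dots> = A #> (x \<otimes> b \<otimes> inv x) [^] k" using x bc by (simp add: conj_int_pow)
    also have "\<dots> = A #> (b [^] m) [^] k" using x bc m by (intro N.coset_int_pow_eq) auto
    also have "\<dots> = A #> (b [^] k) [^] m" using bc by (simp add: int_pow_pow mult.commute)
    also have "\<dots> = A #> s [^] m" using sc bc k by (intro N.coset_int_pow_eq) auto
    finally have "x \<otimes> s \<otimes> inv x \<otimes> inv (s [^] m) \<in> A"
      using x sc N.coset_eq_iff by simp
    then have "x \<otimes> s \<otimes> inv x \<otimes> inv (s [^] m) \<in> S" using S by auto
    moreover have "s [^] m \<in> S" using s S by (simp add: subgroup_int_pow_closed)
    ultimately have "x \<otimes> s \<otimes> inv x \<otimes> inv (s [^] m) \<otimes> s [^] m \<in> S"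
      using subgroup.m_closed[OF S(1)] by blast
    then show "x \<otimes> s \<otimes> inv x \<in> S" using x sc by (simp add: m_assoc)
  qed
qed

lemma (in group) U0_step_refine:
  assumes fin: "finite (carrier G)" and s: "U0_step t G A B"
  shows "(prime_step G)\<^sup>*\<^sup>* A B"
proof -
  have AB: "A \<lhd> G" "B \<lhd> G" "A \<subseteq> B" using s by (auto simp: U0_step_def)
  consider "central_over G A B" | p where "good_prime t p" "card B = p * card A"
    using s by (auto simp: U0_step_def)
  then show ?thesis
  proof cases
    case 1
    show ?thesis
    proof (rule prime_steps_between[OF fin AB])
      fix S assume S: "subgroup S G" "A \<subseteq> S" "S \<subseteq> B"
      have "x \<otimes> s \<otimes> inv x \<in> S" if x: "x \<in> carrier G" and s: "s \<in> S" for x s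
      proof -
        have "s \<in> B" using s S by blast
        then obtain a where a: "a \<in> A" "x \<otimes> s = a \<otimes> s \<otimes> x"
          using 1 x unfolding central_over_def by meson
        have "a \<in> S" using a S by auto
        moreover have "x \<otimes> s \<otimes> inv x = a \<otimes> s"
          using a(2) x \<open>a \<in> S\<close> s subgroup.mem_carrier[OF S(1)] by (simp add: m_assoc)
        ultimately show ?thesis using s S(1) by (simp add: subgroup.m_closed)
      qed
      then show "S \<lhd> G" using S(1) by (simp add: normal_inv_iff)
    qed
  next
    case 2
    then have "prime_step G A B" using AB by (auto simp: prime_step_def good_prime_def)
    then show ?thesis by blast
  qed
qed

text \<open>Both directions change one step at a time: a cyclic factor splits into factors of prime order, and a
  factor of prime order is cyclic.\<close>

lemma (in group) supersoluble_iff: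
  assumes fin: "finite (carrier G)"
  shows "supersoluble G \<longleftrightarrow> (prime_step G)\<^sup>*\<^sup>* {\<one>} (carrier G)"
proof -
  define Q where "Q A B \<longleftrightarrow> A \<subseteq> B \<and> cyclic_group ((G\<lparr>carrier := B\<rparr>) Mod A)" for A B
  let ?R = "\<lambda>A B. A \<lhd> G \<and> B \<lhd> G \<and> Q A B"
  have ss: "supersoluble G \<longleftrightarrow> ?R\<^sup>*\<^sup>* {\<one>} (carrier G)"
    unfolding supersoluble_def
    using chain_iff_rtranclp[of "{\<one>}" "carrier G" "\<lambda>A. A \<lhd> G" Q] one_is_normal
    unfolding Q_def by simp
  have "prime_step G A B \<Longrightarrow> ?R A B" for A B
    using prime_step_imp_cyclic[OF fin] by (auto simp: prime_step_def Q_def)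
  then have 1: "(prime_step G)\<^sup>*\<^sup>* \<le> ?R\<^sup>*\<^sup>*" by (intro rtranclp_mono) auto
  have "?R A B \<Longrightarrow> (prime_step G)\<^sup>*\<^sup>* A B" for A B
    using prime_steps_of_cyclic[OF fin] by (auto simp: Q_def)
  then have "?R\<^sup>*\<^sup>* \<le> ((prime_step G)\<^sup>*\<^sup>*)\<^sup>*\<^sup>*" by (intro rtranclp_mono) auto
  then show ?thesis using ss 1 by (auto simp: rtranclp_idemp)
qed

section \<open>Multiplying and intersecting a series with a subgroup\<close>

lemma prime_split:
  fixes x y u v p :: nat
  assumes "prime p" "x * u = p * (y * v)" "y dvd x" "v dvd u" "y > 0" "v > 0"
  shows "(x = y \<and> u = p * v) \<or> (x = p * y \<and> u = v)"
proof -
  obtain j k where jk: "x = y * j" "u = v * k" using assms(3,4) by (auto simp: dvd_def)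
  then have "(y * v) * (j * k) = (y * v) * p" using assms(2) by (simp add: mult_ac)
  then have "j * k = p" using assms(5,6) by simp
  then have "(j = 1 \<and> k = p) \<or> (j = p \<and> k = 1)"
    using assms(1) by (metis mult.right_neutral mult_1 prime_product)
  then show ?thesis using jk by auto
qed

text \<open>By the product formula, the indices of \<open>A <#> S\<close> in \<open>B <#> S\<close> and of \<open>S \<inter> A\<close> in \<open>S \<inter> B\<close> multiply
  to \<open>p\<close>, so one of them is \<open>1\<close>.\<close>

lemma (in group) prime_index_split:
  assumes fin: "finite (carrier G)" and A: "A \<lhd> G" and B: "B \<lhd> G" and AB: "A \<subseteq> B"
    and p: "prime p" "card B = p * card A" and S: "subgroup S G"
  shows "(B <#> S = A <#> S \<and> card (S \<inter> B) = p * card (S \<inter> A)) \<or>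
         (card (B <#> S) = p * card (A <#> S) \<and> S \<inter> B = S \<inter> A)"
proof -
  interpret A: normal A G by fact
  interpret B: normal B G by fact
  have sub: "subgroup (A <#> S) G" "subgroup (B <#> S) G" "subgroup (S \<inter> A) G" "subgroup (S \<inter> B) G"
    using A.subgroup_set_mult[OF S] B.subgroup_set_mult[OF S] subgroups_Inter_pair S
      A.subgroup_axioms B.subgroup_axioms by auto
  have le: "A <#> S \<subseteq> B <#> S" "S \<inter> A \<subseteq> S \<inter> B" using AB mono_set_mult[OF AB subset_refl] by auto
  have finS: "finite (B <#> S)" "finite (S \<inter> B)"
    using sub fin subgroup.subset finite_subset by metis+
  have "card (B <#> S) * card (S \<inter> B) = p * (card (A <#> S) * card (S \<inter> A))"
    using A.card_set_mult[OF S fin] B.card_set_mult[OF S fin] p(2) by simp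
  then have "(card (B <#> S) = card (A <#> S) \<and> card (S \<inter> B) = p * card (S \<inter> A)) \<or>
    (card (B <#> S) = p * card (A <#> S) \<and> card (S \<inter> B) = card (S \<inter> A))"
    by (intro prime_split p(1) card_subgroup_dvd card_subgroup_pos sub le fin)
  then show ?thesis
    using card_subset_eq[OF finS(1) le(1)] card_subset_eq[OF finS(2) le(2)] by metis
qed

lemma (in group) exists_sylow:
  assumes fin: "finite (carrier G)" and q: "prime q"
  shows "\<exists>P. sylow_subgroup q P G"
proof -
  have "q ^ multiplicity q (order G) dvd order G" by (rule multiplicity_dvd)
  then obtain m where "order G = q ^ multiplicity q (order G) * m" by (rule dvdE)
  then show ?thesis using sylow_thm[OF q is_group _ fin] q unfolding sylow_subgroup_def by blast
qed

lemma (in group) eq_carrier_if_contains_sylows: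
  assumes fin: "finite (carrier G)" and Z: "subgroup Z G"
    and syl: "\<And>q P. sylow_subgroup q P G \<Longrightarrow> P \<subseteq> Z"
  shows "Z = carrier G"
proof -
  have "order G dvd card Z"
  proof (rule multiplicity_le_imp_dvd)
    show "order G \<noteq> 0" using fin order_gt_0_iff_finite by auto
    fix q :: nat assume q: "prime q"
    obtain P where P: "sylow_subgroup q P G" using exists_sylow[OF fin q] by blast
    then have "card P dvd card Z"
      using syl[OF P] Z by (intro card_subgroup_dvd) (auto simp: sylow_subgroup_def)
    then have "q ^ multiplicity q (order G) dvd card Z" using P by (simp add: sylow_subgroup_def)
    then show "multiplicity q (order G) \<le> multiplicity q (card Z)"
      using q card_subgroup_pos[OF Z fin] by (intro multiplicity_geI) auto
  qed
  then have "order G \<le> card Z" using card_subgroup_pos[OF Z fin] by (rule dvd_imp_le)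
  then show ?thesis
    using fin subgroup.subset[OF Z] by (intro card_seteq) (auto simp: order_def)
qed

lemma (in normal) central_over_iff:
  assumes B: "B \<subseteq> carrier G"
  shows "central_over G H B \<longleftrightarrow> (\<forall>x\<in>carrier G. \<forall>b\<in>B. H #> (x \<otimes> b \<otimes> inv x) = H #> b)"
proof -
  have "(\<exists>a\<in>H. x \<otimes> b = a \<otimes> b \<otimes> x) \<longleftrightarrow> H #> (x \<otimes> b \<otimes> inv x) = H #> b"
    if c: "x \<in> carrier G" "b \<in> carrier G" for x b
  proof
    assume "\<exists>a\<in>H. x \<otimes> b = a \<otimes> b \<otimes> x"
    then obtain a where a: "a \<in> H" "x \<otimes> b = a \<otimes> b \<otimes> x" by blast
    have "x \<otimes> b \<otimes> inv x \<otimes> inv b = a"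
      unfolding a(2) using a(1) c subset by (simp add: m_assoc subsetD)
    then show "H #> (x \<otimes> b \<otimes> inv x) = H #> b" using c a coset_eq_iff by simp
  next
    assume "H #> (x \<otimes> b \<otimes> inv x) = H #> b"
    then have "x \<otimes> b \<otimes> inv x \<otimes> inv b \<in> H" using c coset_eq_iff by simp
    moreover have "x \<otimes> b = (x \<otimes> b \<otimes> inv x \<otimes> inv b) \<otimes> b \<otimes> x" using c by (simp add: m_assoc)
    ultimately show "\<exists>a\<in>H. x \<otimes> b = a \<otimes> b \<otimes> x" by blast
  qed
  then show ?thesis unfolding central_over_def using B by blast
qed

text \<open>Multiplying by \<open>M\<close> makes a central step normal: modulo \<open>A\<close>, the elements of \<open>B\<close> commute with those of \<open>M\<close>. A step of
  good prime index keeps its index or becomes trivial.\<close>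

lemma (in group) KP_step_set_mult:
  assumes fin: "finite (carrier G)" and s: "U0_step t G A B" and M: "subgroup M G"
  shows "KP_step t G (A <#> M) (B <#> M)"
proof -
  have AB: "A \<lhd> G" "B \<lhd> G" "A \<subseteq> B" using s by (auto simp: U0_step_def)
  interpret A: normal A G by fact
  interpret B: normal B G by fact
  have sub: "subgroup (A <#> M) G" "subgroup (B <#> M) G"
    using A.subgroup_set_mult[OF M] B.subgroup_set_mult[OF M] .
  have le: "A <#> M \<subseteq> B <#> M" using mono_set_mult[OF AB(3) subset_refl] .
  consider "central_over G A B" | p where "good_prime t p" "card B = p * card A"
    using s by (auto simp: U0_step_def)
  then show ?thesis
  proof cases
    case 1
    have "x \<otimes> y \<otimes> inv x \<in> A <#> M" if x: "x \<in> B <#> M" and y: "y \<in> A <#> M" for x y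
    proof -
      have yc: "y \<in> carrier G" using y sub subgroup.mem_carrier by metis
      obtain b m where bm: "b \<in> B" "m \<in> M" "x = b \<otimes> m" using x by (auto simp: set_mult_def)
      have c: "b \<in> carrier G" "m \<in> carrier G" using bm M B.subset subgroup.mem_carrier by auto
      have mA: "m \<in> A <#> M" using A.subset_set_mult(2)[OF M] bm by blast
      define z where "z = m \<otimes> y \<otimes> inv m"
      have z: "z \<in> A <#> M" unfolding z_def
        using subgroup.m_closed[OF sub(1) subgroup.m_closed[OF sub(1) mA y] subgroup.m_inv_closed[OF sub(1) mA]] .
      have zc: "z \<in> carrier G" using c yc by (simp add: z_def)
      obtain n where n: "n \<in> M" "A #> z = A #> n" using A.mem_set_mult_iff[OF M zc] z by blast
      have nc: "n \<in> carrier G" using n M subgroup.mem_carrier by metis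
      have "A #> (b \<otimes> z \<otimes> inv b) = A #> (b \<otimes> n \<otimes> inv b)"
        using A.coset_conj_eq[OF c(1) zc nc n(2)] .
      also have "\<dots> = A #> n"
      proof -
        have "A #> (n \<otimes> b \<otimes> inv n) = A #> b"
          using 1 A.central_over_iff[OF B.subset] nc bm(1) by blast
        then have "n \<otimes> b \<otimes> inv n \<otimes> inv b \<in> A" using A.coset_eq_iff nc c by simp
        then have "inv (n \<otimes> b \<otimes> inv n \<otimes> inv b) \<in> A" by (rule A.m_inv_closed)
        then have "b \<otimes> n \<otimes> inv b \<otimes> inv n \<in> A" using nc c by (simp add: inv_mult_group m_assoc)
        then show ?thesis using A.coset_eq_iff nc c by simp
      qed
      finally have "b \<otimes> z \<otimes> inv b \<in> A <#> M"
        using A.mem_set_mult_iff[OF M, of "b \<otimes> z \<otimes> inv b"] n(1) c zc by auto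
      moreover have "b \<otimes> z \<otimes> inv b = x \<otimes> y \<otimes> inv x"
        unfolding z_def bm(3) using c yc by (simp add: m_assoc inv_mult_group)
      ultimately show ?thesis by simp
    qed
    then show ?thesis unfolding KP_step_def using sub le by blast
  next
    case 2
    have "prime p" using 2 by (simp add: good_prime_def)
    from prime_index_split[OF fin AB this 2(2) M]
    have "B <#> M = A <#> M \<or> card (B <#> M) = p * card (A <#> M)" by blast
    then show ?thesis
    proof
      assume eq: "B <#> M = A <#> M"
      show ?thesis unfolding KP_step_def eq
        using sub(1) by (auto simp: subgroup.m_closed subgroup.m_inv_closed)
    next
      assume "card (B <#> M) = p * card (A <#> M)"
      then show ?thesis unfolding KP_step_def using sub le 2(1) by blast
    qed
  qed
qed

lemma (in group) set_mult_absorb: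
  assumes "subgroup A G" "subgroup M G" "A \<subseteq> M"
  shows "A <#> M = M" "M <#> A = M"
proof -
  show "A <#> M = M"
  proof
    show "A <#> M \<subseteq> M" using assms by (auto simp: set_mult_def subgroup.m_closed)
    show "M \<subseteq> A <#> M"
    proof
      fix m assume m: "m \<in> M"
      then have "m = \<one> \<otimes> m" using assms subgroup.mem_carrier by fastforce
      then show "m \<in> A <#> M" using m subgroup.one_closed[OF assms(1)] unfolding set_mult_def by fast
    qed
  qed
  show "M <#> A = M"
  proof
    show "M <#> A \<subseteq> M" using assms by (auto simp: set_mult_def subgroup.m_closed)
    show "M \<subseteq> M <#> A"
    proof
      fix m assume m: "m \<in> M"
      then have "m = m \<otimes> \<one>" using assms subgroup.mem_carrier by fastforce
      then show "m \<in> M <#> A" using m subgroup.one_closed[OF assms(1)] unfolding set_mult_def by fast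
    qed
  qed
qed

text \<open>In particular, in a group of the class \<open>U0 t\<close> all subgroups are \<open>KP\<close>-subnormal, not only
  the Sylow subgroups.\<close>

lemma (in group) KP_steps_of_U0_steps:
  assumes fin: "finite (carrier G)" and s: "(U0_step t G)\<^sup>*\<^sup>* N (carrier G)"
    and N: "subgroup N G" and M: "subgroup M G" and NM: "N \<subseteq> M"
  shows "(KP_step t G)\<^sup>*\<^sup>* M (carrier G)"
proof -
  have "(KP_step t G)\<^sup>*\<^sup>* (N <#> M) (carrier G <#> M)" using s
  proof (induction rule: rtranclp_induct)
    case (step B C)
    then show ?case using KP_step_set_mult[OF fin _ M] by (metis rtranclp.rtrancl_into_rtrancl)
  qed simp
  then show ?thesis
    using set_mult_absorb(1)[OF N M NM] set_mult_absorb(2)[OF M subgroup_self subgroup.subset[OF M]]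
    by simp
qed

section \<open>Sections of prime order\<close>

text \<open>Conjugation by a \<open>p\<close>-element permutes the \<open>p\<close> cosets of \<open>H\<close> in \<open>B\<close> and fixes the coset \<open>H\<close>.\<close>

lemma (in normal) fixes_prime_section:
  assumes fin: "finite (carrier G)" and B: "subgroup B G" "H \<subseteq> B" "\<And>x b. x \<in> carrier G \<Longrightarrow> b \<in> B \<Longrightarrow> x \<otimes> b \<otimes> inv x \<in> B"
    and p: "prime p" "card B = p * card H" and x: "x \<in> carrier G" "x [^] (p ^ k :: nat) = \<one>"
    and b: "b \<in> B"
  shows "H #> (x \<otimes> b \<otimes> inv x) = H #> b"
proof -
  interpret q: group_hom G "G Mod H" "\<lambda>x. H #> x" by (rule quotient_hom)
  define S where "S = (\<lambda>x. H #> x) ` B"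
  define f where "f c = (H #> x) \<otimes>\<^bsub>G Mod H\<^esub> c \<otimes>\<^bsub>G Mod H\<^esub> inv\<^bsub>G Mod H\<^esub> (H #> x)" for c
  note [simp] = subgroup.mem_carrier[OF B(1)]
  have fc: "f (H #> y) = H #> (x \<otimes> y \<otimes> inv x)" if "y \<in> carrier G" for y
    unfolding f_def using that x q.hom_mult[of x y] q.hom_mult[of "x \<otimes> y" "inv x"] q.hom_inv[of x]
    by (simp del: mult_FactGroup)
  have fn: "(f ^^ n) (H #> y) = H #> (x [^] n \<otimes> y \<otimes> inv (x [^] n))" if y: "y \<in> carrier G"
    for y and n :: nat
  proof (induction n)
    case (Suc n)
    have "f (H #> (x [^] n \<otimes> y \<otimes> inv (x [^] n))) = H #> (x \<otimes> (x [^] n \<otimes> y \<otimes> inv (x [^] n)) \<otimes> inv x)"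
      using x y by (intro fc) simp
    moreover have "x \<otimes> (x [^] n \<otimes> y \<otimes> inv (x [^] n)) \<otimes> inv x = x [^] Suc n \<otimes> y \<otimes> inv (x [^] Suc n)"
      unfolding nat_pow_Suc2[OF x(1)] using x y by (simp add: m_assoc inv_mult_group)
    ultimately show ?case using Suc by simp
  qed (use y in simp)
  have "S = rcosets\<^bsub>G\<lparr>carrier := B\<rparr>\<^esub> H" by (auto simp: S_def RCOSETS_def)
  then have "card S * card H = card B"
    using subgroup_index_mult_card[OF subgroup_axioms B(1,2)] by (simp add: subgroup_index_def)
  then have cS: "card S \<le> p" using p(2) card_subgroup_pos[OF subgroup_axioms fin] by simp
  have fS: "finite S" unfolding S_def using finite_subset[OF subgroup.subset[OF B(1)] fin] by (rule finite_imageI)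
  have "f (H #> b) = H #> b"
  proof (rule fixes_all_if_fixes_one[OF p(1) fS cS, of H])
    have one: "H = H #> \<one>" using subset by simp
    show "H \<in> S" unfolding S_def using one subgroup.one_closed[OF B(1)] by (rule image_eqI)
    show "f H = H" using fc[OF one_closed] one x by simp
    show "f s \<in> S" if s: "s \<in> S" for s
    proof -
      obtain y where y: "y \<in> B" "s = H #> y" using s by (auto simp: S_def)
      then have "f s = H #> (x \<otimes> y \<otimes> inv x)" using fc by simp
      then show ?thesis using B(3)[OF x(1) y(1)] by (auto simp: S_def)
    qed
    show "(f ^^ (p ^ k)) s = s" if s: "s \<in> S" for s
    proof -
      obtain y where y: "y \<in> B" "s = H #> y" using s by (auto simp: S_def)
      then show ?thesis using fn[of y "p ^ k"] x by simp
    qed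
    show "H #> b \<in> S" using b by (simp add: S_def)
  qed
  then show ?thesis using fc b by simp
qed

lemma (in group) subgroup_pow_card_eq_one:
  assumes "subgroup P G" "finite (carrier G)" "x \<in> P"
  shows "x [^] card P = \<one>"
proof -
  interpret P: group "G\<lparr>carrier := P\<rparr>"
    using assms(1) by (rule subgroup.subgroup_is_group) (rule is_group)
  show ?thesis using P.pow_order_eq_1[of x] assms(3) nat_pow_consistent[of x "card P" P]
    by (simp add: order_def)
qed

text \<open>Follow a \<open>KP\<close> chain upwards from \<open>Q\<close>. Its bottom meets \<open>B\<close> inside \<open>A\<close>, because \<open>p\<close> does not divide the
  order of \<open>Q\<close>, and its top does not. Consider the first step \<open>C \<subseteq> D\<close> at which \<open>D \<inter> B\<close> is not in \<open>A\<close>; then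
  \<open>B \<subseteq> A <#> D\<close>. If \<open>C\<close> is normal in \<open>D\<close>, then the commutators of \<open>Q\<close> with \<open>D \<inter> B\<close> lie in \<open>C \<inter> B \<subseteq> A\<close>, so \<open>Q\<close>
  centralizes \<open>B/A\<close>. If the index is a prime, then \<open>p\<close> divides it, so it is \<open>p\<close>, which is not good.\<close>

lemma (in group) coprime_centralizes_bad_section:
  assumes fin: "finite (carrier G)" and A: "A \<lhd> G" and B: "B \<lhd> G" and AB: "A \<subseteq> B"
    and p: "prime p" "card B = p * card A" and bad: "\<not> good_prime t p"
    and Q: "(KP_step t G)\<^sup>*\<^sup>* Q (carrier G)" "subgroup Q G" "\<not> p dvd card Q"
    and x: "x \<in> Q" and b: "b \<in> B"
  shows "A #> (x \<otimes> b \<otimes> inv x) = A #> b"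
proof (rule ccontr)
  assume contra: "A #> (x \<otimes> b \<otimes> inv x) \<noteq> A #> b"
  interpret A: normal A G by fact
  interpret B: normal B G by fact
  have neq: "card A < card B"
    using p card_subgroup_pos[OF A.subgroup_axioms fin] prime_gt_1_nat by simp
  have "Q \<subseteq> C \<and> C \<inter> B = C \<inter> A" if "(KP_step t G)\<^sup>*\<^sup>* Q C" for C
    using that
  proof (induction rule: rtranclp_induct)
    case base
    have "card (Q \<inter> B) dvd card Q"
      using Q(2) B.subgroup_axioms by (intro card_subgroup_dvd subgroups_Inter_pair) auto
    then have "card (Q \<inter> B) \<noteq> p * card (Q \<inter> A)" using Q(3) by (metis dvd_mult_left)
    then show ?case using prime_index_split[OF fin A B AB p Q(2)] by blast
  next
    case (step C D)
    have CD: "subgroup C G" "subgroup D G" "C \<subseteq> D" using step.hyps(2) by (auto simp: KP_step_def)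
    have QC: "Q \<subseteq> C" "C \<inter> B = C \<inter> A" using step.IH by auto
    have False if ne: "D \<inter> B \<noteq> D \<inter> A"
    proof -
      have sp: "B <#> D = A <#> D" "card (D \<inter> B) = p * card (D \<inter> A)"
        using prime_index_split[OF fin A B AB p CD(2)] ne by auto
      consider "\<forall>x\<in>D. \<forall>a\<in>C. x \<otimes> a \<otimes> inv x \<in> C" | r where "good_prime t r" "card D = r * card C"
        using step.hyps(2) by (auto simp: KP_step_def)
      then show False
      proof cases
        case 1
        have bc: "b \<in> carrier G" using b B.subset by auto
        have xC: "x \<in> C" using x QC by auto
        have xc: "x \<in> carrier G" using x Q(2) subgroup.mem_carrier by metis
        \<comment> \<open>Modulo \<open>A\<close>, the element \<open>b\<close> may be replaced by some \<open>d \<in> D \<inter> B\<close>.\<close>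
        have "b \<in> A <#> D" using b B.subset_set_mult(1)[OF CD(2)] sp by auto
        then obtain d where d: "d \<in> D" "A #> b = A #> d" using A.mem_set_mult_iff[OF CD(2) bc] by blast
        have dc: "d \<in> carrier G" using d CD subgroup.mem_carrier by metis
        have "b \<otimes> inv d \<in> A" using d(2) bc dc A.coset_eq_iff by blast
        then have "inv (b \<otimes> inv d) \<in> B" using AB B.m_inv_closed by blast
        then have "inv (b \<otimes> inv d) \<otimes> b \<in> B" using b B.m_closed by blast
        then have dB: "d \<in> B" using bc dc by (simp add: inv_mult_group m_assoc)
        have "x \<otimes> (d \<otimes> inv x \<otimes> inv d) \<in> C"
          using 1 d(1) xC CD(1) by (simp add: subgroup.m_closed subgroup.m_inv_closed)
        moreover have "(x \<otimes> d \<otimes> inv x) \<otimes> inv d \<in> B"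
          using B.inv_op_closed2[OF xc dB] dB B.m_inv_closed B.m_closed by blast
        ultimately have "(x \<otimes> d \<otimes> inv x) \<otimes> inv d \<in> C \<inter> B" using xc dc by (simp add: m_assoc)
        then have "(x \<otimes> d \<otimes> inv x) \<otimes> inv d \<in> A" using QC by auto
        then have "A #> (x \<otimes> d \<otimes> inv x) = A #> d" using A.coset_eq_iff xc dc by simp
        moreover have "A #> (x \<otimes> b \<otimes> inv x) = A #> (x \<otimes> d \<otimes> inv x)"
          by (rule A.coset_conj_eq[OF xc bc dc d(2)])
        ultimately show False using contra d(2) by simp
      next
        case 2
        have "C \<inter> A \<subseteq> D \<inter> A" using CD by auto
        then have "card (C \<inter> A) dvd card (D \<inter> A)"
          using CD A.subgroup_axioms by (intro card_subgroup_dvd subgroups_Inter_pair)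
        then obtain k where k: "card (D \<inter> A) = card (C \<inter> A) * k" by (rule dvdE)
        have "card (B <#> C) dvd card (B <#> D)"
          using CD by (intro card_subgroup_dvd B.subgroup_set_mult mono_set_mult subset_refl)
        then obtain j where j: "card (B <#> D) = card (B <#> C) * j" by (rule dvdE)
        have pos: "card (B <#> C) > 0" "card (C \<inter> A) > 0"
          using CD A.subgroup_axioms by (auto intro!: card_subgroup_pos B.subgroup_set_mult fin subgroups_Inter_pair)
        have "card (B <#> D) * card (D \<inter> B) = r * (card (B <#> C) * card (C \<inter> A))"
          using B.card_set_mult[OF CD(1) fin] B.card_set_mult[OF CD(2) fin] 2(2) QC(2) by simp
        \<comment> \<open>Compare the orders of \<open>D\<close> and \<open>C\<close> through the product formula; \<open>p\<close> comes from \<open>D \<inter> B\<close>.\<close>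
        then have "(card (B <#> C) * card (C \<inter> A)) * (p * (j * k)) = (card (B <#> C) * card (C \<inter> A)) * r"
          unfolding j sp(2) k by (simp only: mult_ac)
        then have "p * (j * k) = r" using pos by simp
        then have "p dvd r" by auto
        then have "p = r" using p(1) 2(1) primes_dvd_imp_eq unfolding good_prime_def by blast
        then show False using 2(1) bad by simp
      qed
    qed
    then show ?case using QC(1) CD(3) by blast
  qed
  from this[OF Q(1)] have "carrier G \<inter> B = carrier G \<inter> A" by blast
  then have "A = B" using A.subset B.subset by blast
  then show False using neq by simp
qed

lemma (in group) conj_inverse_cancel:
  assumes "x \<in> carrier G" "y \<in> carrier G"
  shows "inv x \<otimes> (x \<otimes> y \<otimes> inv x) \<otimes> inv (inv x) = y"
proof -
  have "inv x \<otimes> (x \<otimes> y) = y" using m_assoc[of "inv x" x y] assms by simp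
  then show ?thesis using assms by (simp add: m_assoc)
qed

definition section_centralizer :: "('a, 'b) monoid_scheme \<Rightarrow> 'a set \<Rightarrow> 'a set \<Rightarrow> 'a set" where
  "section_centralizer G A B =
     {x \<in> carrier G. \<forall>b\<in>B. A #>\<^bsub>G\<^esub> (x \<otimes>\<^bsub>G\<^esub> b \<otimes>\<^bsub>G\<^esub> inv\<^bsub>G\<^esub> x) = A #>\<^bsub>G\<^esub> b}"

text \<open>This is the kernel of the action of \<open>G\<close> on \<open>B/A\<close> by conjugation.\<close>

lemma (in group) section_centralizer_normal:
  assumes A: "A \<lhd> G" and B: "B \<lhd> G"
  shows "section_centralizer G A B \<lhd> G"
proof -
  interpret A: normal A G by fact
  interpret B: normal B G by fact
  define Z where "Z = section_centralizer G A B"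
  note Z_def = Z_def[unfolded section_centralizer_def]
  note [simp] = subsetD[OF B.subset]
  have inv: "inv x \<in> Z" if "x \<in> Z" for x
  proof -
    have x: "x \<in> carrier G" "\<And>b. b \<in> B \<Longrightarrow> A #> (x \<otimes> b \<otimes> inv x) = A #> b"
      using that by (auto simp: Z_def)
    have "A #> (inv x \<otimes> b \<otimes> inv (inv x)) = A #> b" if b: "b \<in> B" for b
    proof -
      have "A #> (inv x \<otimes> b \<otimes> inv (inv x)) = A #> (inv x \<otimes> (x \<otimes> b \<otimes> inv x) \<otimes> inv (inv x))"
        using x b by (intro A.coset_conj_eq) auto
      also have "inv x \<otimes> (x \<otimes> b \<otimes> inv x) \<otimes> inv (inv x) = b"
        using x(1) b by (intro conj_inverse_cancel) simp_all
      finally show ?thesis .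
    qed
    then show ?thesis using x(1) by (simp add: Z_def)
  qed
  have mult: "x \<otimes> y \<in> Z" if "x \<in> Z" "y \<in> Z" for x y
  proof -
    have xy: "x \<in> carrier G" "y \<in> carrier G"
      "\<And>b. b \<in> B \<Longrightarrow> A #> (x \<otimes> b \<otimes> inv x) = A #> b"
      "\<And>b. b \<in> B \<Longrightarrow> A #> (y \<otimes> b \<otimes> inv y) = A #> b"
      using that by (auto simp: Z_def)
    have "A #> (x \<otimes> y \<otimes> b \<otimes> inv (x \<otimes> y)) = A #> b" if b: "b \<in> B" for b
    proof -
      have "x \<otimes> y \<otimes> b \<otimes> inv (x \<otimes> y) = x \<otimes> (y \<otimes> b \<otimes> inv y) \<otimes> inv x"
        using xy(1,2) b by (simp add: m_assoc inv_mult_group)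
      also have "A #> \<dots> = A #> (y \<otimes> b \<otimes> inv y)"
        by (rule xy(3)[OF B.inv_op_closed2[OF xy(2) b]])
      also have "\<dots> = A #> b" by (rule xy(4)[OF b])
      finally show ?thesis .
    qed
    then show ?thesis using xy(1,2) by (simp add: Z_def)
  qed
  have "\<one> \<in> Z" by (simp add: Z_def)
  then have Z: "subgroup Z G"
    using inv mult by (intro subgroupI) (auto simp: Z_def)
  have "x \<otimes> z \<otimes> inv x \<in> Z" if x: "x \<in> carrier G" and z: "z \<in> Z" for x z
  proof -
    have zc: "z \<in> carrier G" using z by (simp add: Z_def)
    have "A #> ((x \<otimes> z \<otimes> inv x) \<otimes> b \<otimes> inv (x \<otimes> z \<otimes> inv x)) = A #> b" if b: "b \<in> B" for b
    proof -
      define d where "d = inv x \<otimes> b \<otimes> x"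
      have d: "d \<in> B" unfolding d_def using B.inv_op_closed1[OF x b] .
      have "(x \<otimes> z \<otimes> inv x) \<otimes> b \<otimes> inv (x \<otimes> z \<otimes> inv x) = x \<otimes> (z \<otimes> d \<otimes> inv z) \<otimes> inv x"
        unfolding d_def using x zc b by (simp add: m_assoc inv_mult_group)
      also have "A #> \<dots> = A #> (x \<otimes> d \<otimes> inv x)"
        using x zc d z by (intro A.coset_conj_eq) (auto simp: Z_def)
      also have "x \<otimes> d \<otimes> inv x = b"
        unfolding d_def using conj_inverse_cancel[of "inv x" b] x b by simp
      finally show ?thesis .
    qed
    then show ?thesis using x zc by (simp add: Z_def)
  qed
  then show ?thesis using Z unfolding normal_inv_iff Z_def section_centralizer_def by blast
qed

text \<open>The centralizer of \<open>B/A\<close> contains every Sylow subgroup, so it is all of \<open>G\<close>.\<close>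

lemma (in group) bad_section_central:
  assumes fin: "finite (carrier G)" and A: "A \<lhd> G" and B: "B \<lhd> G" and AB: "A \<subseteq> B"
    and p: "prime p" "card B = p * card A" and bad: "\<not> good_prime t p"
    and syl: "\<And>q P. sylow_subgroup q P G \<Longrightarrow> (KP_step t G)\<^sup>*\<^sup>* P (carrier G)"
  shows "central_over G A B"
proof -
  interpret A: normal A G by fact
  interpret B: normal B G by fact
  define Z where "Z = section_centralizer G A B"
  have Z: "subgroup Z G" unfolding Z_def using section_centralizer_normal[OF A B] by (rule normal_imp_subgroup)
  note Z_def = Z_def[unfolded section_centralizer_def]
  have "P \<subseteq> Z" if P: "sylow_subgroup q P G" for q P
  proof
    fix x assume x: "x \<in> P"
    have PG: "subgroup P G" "prime q" "card P = q ^ multiplicity q (order G)"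
      using P by (auto simp: sylow_subgroup_def)
    have xc: "x \<in> carrier G" using x PG(1) subgroup.mem_carrier by metis
    have "A #> (x \<otimes> b \<otimes> inv x) = A #> b" if b: "b \<in> B" for b
    proof (cases "q = p")
      case True
      have "x [^] (p ^ multiplicity q (order G)) = \<one>"
        using subgroup_pow_card_eq_one[OF PG(1) fin x] PG(3) True by simp
      then show ?thesis
        by (intro A.fixes_prime_section[OF fin B.subgroup_axioms AB _ p xc _ b] B.inv_op_closed2)
    next
      case False
      have "\<not> p dvd card P"
        using False PG(2,3) p(1) by (metis prime_dvd_power primes_dvd_imp_eq)
      then show ?thesis
        by (rule coprime_centralizes_bad_section[OF fin A B AB p bad syl[OF P] PG(1) _ x b])
    qed
    then show "x \<in> Z" using xc by (simp add: Z_def)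
  qed
  then have "Z = carrier G" by (rule eq_carrier_if_contains_sylows[OF fin Z])
  then show ?thesis unfolding A.central_over_iff[OF B.subset] by (auto simp: Z_def)
qed

section \<open>A local description of the class\<close>

text \<open>The local description of the class \<open>U0 t\<close>. Chains of normal subgroups are much easier to
  restrict, intersect and transport than the conditions on Sylow subgroups on the left.\<close>

lemma (in group) supersoluble_KP_sylows_iff:
  assumes fin: "finite (carrier G)"
  shows "supersoluble G \<and> (\<forall>q P. sylow_subgroup q P G \<longrightarrow> KP_subnormal t P G) \<longleftrightarrow>
    (U0_step t G)\<^sup>*\<^sup>* {\<one>} (carrier G)"
proof
  assume *: "supersoluble G \<and> (\<forall>q P. sylow_subgroup q P G \<longrightarrow> KP_subnormal t P G)"
  then have syl: "(KP_step t G)\<^sup>*\<^sup>* P (carrier G)" if "sylow_subgroup q P G" for q P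
    using that KP_subnormal_iff[OF fin] by blast
  have "U0_step t G A B" if "prime_step G A B" for A B
  proof -
    obtain p where AB: "A \<lhd> G" "B \<lhd> G" "A \<subseteq> B" and p: "prime p" "card B = p * card A"
      using \<open>prime_step G A B\<close> by (auto simp: prime_step_def)
    show ?thesis
    proof (cases "good_prime t p")
      case False
      have "central_over G A B" by (rule bad_section_central[OF fin AB p False syl])
      then show ?thesis using AB by (simp add: U0_step_def)
    qed (use AB p in \<open>auto simp: U0_step_def\<close>)
  qed
  then have "(prime_step G)\<^sup>*\<^sup>* \<le> (U0_step t G)\<^sup>*\<^sup>*" by (intro rtranclp_mono) auto
  then show "(U0_step t G)\<^sup>*\<^sup>* {\<one>} (carrier G)" using * supersoluble_iff[OF fin] by auto
next
  assume s: "(U0_step t G)\<^sup>*\<^sup>* {\<one>} (carrier G)"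
  have "U0_step t G \<le> (prime_step G)\<^sup>*\<^sup>*" using U0_step_refine[OF fin] by auto
  then have "(U0_step t G)\<^sup>*\<^sup>* \<le> (prime_step G)\<^sup>*\<^sup>*" by (metis rtranclp_mono rtranclp_idemp)
  then have "supersoluble G" using s supersoluble_iff[OF fin] by auto
  moreover have "KP_subnormal t P G" if "sylow_subgroup q P G" for q P
  proof -
    have P: "subgroup P G" using that by (simp add: sylow_subgroup_def)
    then show ?thesis
      using KP_steps_of_U0_steps[OF fin s triv_subgroup P] subgroup.one_closed[OF P]
        KP_subnormal_iff[OF fin] by simp
  qed
  ultimately show "supersoluble G \<and> (\<forall>q P. sylow_subgroup q P G \<longrightarrow> KP_subnormal t P G)" by blast
qed

section \<open>Quotients in the class and the residual\<close>

text \<open>A chain from \<open>M\<close> to \<open>G\<close>, intersected with \<open>N\<close>, runs from \<open>N \<inter> M\<close> to \<open>N\<close>, where the chain above \<open>N\<close> continues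
  it.\<close>

lemma (in group) U0_steps_Int:
  assumes fin: "finite (carrier G)" and N: "N \<lhd> G" "(U0_step t G)\<^sup>*\<^sup>* N (carrier G)"
    and M: "(U0_step t G)\<^sup>*\<^sup>* M (carrier G)"
  shows "(U0_step t G)\<^sup>*\<^sup>* (N \<inter> M) (carrier G)"
proof -
  interpret N: normal N G by fact
  have restrict: "(U0_step t G)\<^sup>*\<^sup>* (N \<inter> A) (N \<inter> B)" if s: "U0_step t G A B" for A B
  proof -
    have AB: "A \<lhd> G" "B \<lhd> G" "A \<subseteq> B" using s by (auto simp: U0_step_def)
    have I: "(N \<inter> A) \<lhd> G" "(N \<inter> B) \<lhd> G" "N \<inter> A \<subseteq> N \<inter> B"
      using AB N(1) normal_subgroup_intersect by auto
    consider "central_over G A B" | p where "good_prime t p" "card B = p * card A"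
      using s by (auto simp: U0_step_def)
    then show ?thesis
    proof cases
      case 1
      have "\<exists>a\<in>N \<inter> A. x \<otimes> b = a \<otimes> b \<otimes> x" if x: "x \<in> carrier G" and b: "b \<in> N \<inter> B" for x b
      proof -
        obtain a where a: "a \<in> A" "x \<otimes> b = a \<otimes> b \<otimes> x"
          using 1 x b unfolding central_over_def by (meson IntD2)
        have ac: "a \<in> carrier G" using a AB(1) by (meson normal_imp_subgroup subgroup.mem_carrier)
        have bc: "b \<in> carrier G" using b N.subset by auto
        have "x \<otimes> b \<otimes> inv x \<otimes> inv b \<in> N" using x b N.inv_op_closed2 by simp
        moreover have "x \<otimes> b \<otimes> inv x \<otimes> inv b = a" unfolding a(2) using ac bc x by (simp add: m_assoc)
        ultimately show ?thesis using a by auto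
      qed
      then have "central_over G (N \<inter> A) (N \<inter> B)" by (simp add: central_over_def)
      then have "U0_step t G (N \<inter> A) (N \<inter> B)" unfolding U0_step_def using I by simp
      then show ?thesis by (rule r_into_rtranclp)
    next
      case 2
      have p: "prime p" using 2 by (simp add: good_prime_def)
      from prime_index_split[OF fin AB p 2(2) N.subgroup_axioms]
      have "card (N \<inter> B) = p * card (N \<inter> A) \<or> N \<inter> B = N \<inter> A" by linarith
      then show ?thesis
      proof
        assume "card (N \<inter> B) = p * card (N \<inter> A)"
        then have "U0_step t G (N \<inter> A) (N \<inter> B)" unfolding U0_step_def using I 2(1) by blast
        then show ?thesis by (rule r_into_rtranclp)
      qed simp
    qed
  qed
  have "(U0_step t G)\<^sup>*\<^sup>* (N \<inter> M) (N \<inter> carrier G)" using M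
  proof (induction rule: rtranclp_induct)
    case (step A B)
    show ?case by (rule rtranclp_trans[OF step.IH restrict[OF step.hyps(2)]])
  qed simp
  moreover have "N \<inter> carrier G = N" using N.subset by auto
  ultimately show ?thesis using N(2) by simp
qed

context group_hom
begin

lemma subgroup_preimage:
  assumes A: "subgroup A H"
  shows "subgroup {x \<in> carrier G. h x \<in> A} G"
proof (rule G.subgroupI)
  have "\<one> \<in> {x \<in> carrier G. h x \<in> A}" using subgroup.one_closed[OF A] by simp
  then show "{x \<in> carrier G. h x \<in> A} \<noteq> {}" by blast
qed (use subgroup.m_closed[OF A] subgroup.m_inv_closed[OF A] in auto)

lemma normal_preimage:
  assumes A: "A \<lhd> H"
  shows "{x \<in> carrier G. h x \<in> A} \<lhd> G"
  unfolding G.normal_inv_iff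
  using subgroup_preimage[OF normal_imp_subgroup[OF A]] normal.inv_op_closed2[OF A] by auto

lemma card_preimage:
  assumes fin: "finite (carrier G)" and surj: "h ` carrier G = carrier H" and A: "subgroup A H"
  shows "card {x \<in> carrier G. h x \<in> A} = card A * card (kernel G H h)"
proof -
  let ?S = "{x \<in> carrier G. h x \<in> A}"
  have "h ` ?S = A" using surj subgroup.subset[OF A] by auto
  moreover have "{x \<in> ?S. h x = \<one>\<^bsub>H\<^esub>} = kernel G H h"
    using subgroup.one_closed[OF A] by (auto simp: kernel_def)
  ultimately show ?thesis using card_image_kernel[OF subgroup_preimage[OF A]] fin by simp
qed

lemma normal_image:
  assumes surj: "h ` carrier G = carrier H" and A: "A \<lhd> G"
  shows "h ` A \<lhd> H"
  unfolding H.normal_inv_iff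
proof (intro conjI ballI)
  have sub: "subgroup A G" using A by (rule normal_imp_subgroup)
  show "subgroup (h ` A) H" using sub by (rule subgroup_img_is_subgroup)
  fix y b assume yb: "y \<in> carrier H" "b \<in> h ` A"
  from yb(1) obtain x where "x \<in> carrier G" "y = h x" unfolding surj[symmetric] by (rule imageE)
  moreover from yb(2) obtain a where "a \<in> A" "b = h a" by (rule imageE)
  ultimately have xa: "x \<in> carrier G" "y = h x" "a \<in> A" "b = h a" by auto
  then have "y \<otimes>\<^bsub>H\<^esub> b \<otimes>\<^bsub>H\<^esub> inv\<^bsub>H\<^esub> y = h (x \<otimes> a \<otimes> inv x)"
    using subgroup.mem_carrier[OF sub] by simp
  then show "y \<otimes>\<^bsub>H\<^esub> b \<otimes>\<^bsub>H\<^esub> inv\<^bsub>H\<^esub> y \<in> h ` A" using normal.inv_op_closed2[OF A] xa by simp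
qed

lemma U0_step_preimage:
  assumes fin: "finite (carrier G)" and surj: "h ` carrier G = carrier H" and s: "U0_step t H A B"
  shows "U0_step t G {x \<in> carrier G. h x \<in> A} {x \<in> carrier G. h x \<in> B}"
proof -
  have AB: "A \<lhd> H" "B \<lhd> H" "A \<subseteq> B" using s by (auto simp: U0_step_def)
  consider "central_over H A B" | p where "good_prime t p" "card B = p * card A"
    using s by (auto simp: U0_step_def)
  then show ?thesis
  proof cases
    case 1
    have "\<exists>a\<in>{x \<in> carrier G. h x \<in> A}. x \<otimes> b = a \<otimes> b \<otimes> x"
      if x: "x \<in> carrier G" and b: "b \<in> carrier G" "h b \<in> B" for x b
    proof -
      obtain a where a: "a \<in> A" "h x \<otimes>\<^bsub>H\<^esub> h b = a \<otimes>\<^bsub>H\<^esub> h b \<otimes>\<^bsub>H\<^esub> h x"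
        using 1 hom_closed[OF x] b(2) unfolding central_over_def by meson
      have ac: "a \<in> carrier H" using a AB(1) by (meson normal_imp_subgroup subgroup.mem_carrier)
      have "h (x \<otimes> b \<otimes> inv x \<otimes> inv b) = h x \<otimes>\<^bsub>H\<^esub> h b \<otimes>\<^bsub>H\<^esub> inv\<^bsub>H\<^esub> h x \<otimes>\<^bsub>H\<^esub> inv\<^bsub>H\<^esub> h b"
        using x b by simp
      also have "\<dots> = a" unfolding a(2) using x b ac by (simp add: H.m_assoc)
      finally have "x \<otimes> b \<otimes> inv x \<otimes> inv b \<in> {x \<in> carrier G. h x \<in> A}" using x b a by simp
      moreover have "x \<otimes> b = (x \<otimes> b \<otimes> inv x \<otimes> inv b) \<otimes> b \<otimes> x" using x b by (simp add: G.m_assoc)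
      ultimately show ?thesis by blast
    qed
    then have "central_over G {x \<in> carrier G. h x \<in> A} {x \<in> carrier G. h x \<in> B}"
      by (simp add: central_over_def)
    then show ?thesis unfolding U0_step_def using AB normal_preimage by auto
  next
    case 2
    then show ?thesis unfolding U0_step_def
      using AB normal_preimage card_preimage[OF fin surj normal_imp_subgroup] by auto
  qed
qed

lemma U0_step_image:
  assumes fin: "finite (carrier G)" and surj: "h ` carrier G = carrier H"
    and s: "U0_step t G A B" and ker: "kernel G H h \<subseteq> A"
  shows "U0_step t H (h ` A) (h ` B)"
proof -
  have AB: "A \<lhd> G" "B \<lhd> G" "A \<subseteq> B" using s by (auto simp: U0_step_def)
  have sub: "subgroup A G" "subgroup B G" using AB by (auto simp: normal_imp_subgroup)
  have I: "h ` A \<lhd> H" "h ` B \<lhd> H" "h ` A \<subseteq> h ` B" using AB normal_image[OF surj] by auto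
  consider "central_over G A B" | p where "good_prime t p" "card B = p * card A"
    using s by (auto simp: U0_step_def)
  then show ?thesis
  proof cases
    case 1
    have "\<exists>a\<in>h ` A. y \<otimes>\<^bsub>H\<^esub> c = a \<otimes>\<^bsub>H\<^esub> c \<otimes>\<^bsub>H\<^esub> y" if y: "y \<in> carrier H" and c: "c \<in> h ` B" for y c
    proof -
      from y obtain x where x: "x \<in> carrier G" "y = h x" unfolding surj[symmetric] by (rule imageE)
      from c obtain b where b: "b \<in> B" "c = h b" by (rule imageE)
      obtain a where a: "a \<in> A" "x \<otimes> b = a \<otimes> b \<otimes> x"
        using 1 x(1) b(1) unfolding central_over_def by meson
      have cc: "a \<in> carrier G" "b \<in> carrier G" using a b sub subgroup.mem_carrier by metis+
      have "h (x \<otimes> b) = h (a \<otimes> b \<otimes> x)" using a(2) by simp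
      then have "y \<otimes>\<^bsub>H\<^esub> c = h a \<otimes>\<^bsub>H\<^esub> c \<otimes>\<^bsub>H\<^esub> y" using cc x b by simp
      then show ?thesis using a(1) by blast
    qed
    then have "central_over H (h ` A) (h ` B)" by (simp add: central_over_def)
    then show ?thesis unfolding U0_step_def using I by simp
  next
    case 2
    have c: "card S = card (h ` S) * card (kernel G H h)" if "subgroup S G" "A \<subseteq> S" for S
    proof -
      have "{x \<in> S. h x = \<one>\<^bsub>H\<^esub>} = kernel G H h"
        using that ker subgroup.subset[OF that(1)] by (auto simp: kernel_def)
      then show ?thesis
        using card_image_kernel[OF that(1)] finite_subset[OF subgroup.subset[OF that(1)] fin] by simp
    qed
    have "card (h ` B) * card (kernel G H h) = (p * card (h ` A)) * card (kernel G H h)"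
      using c[OF sub(1)] c[OF sub(2) AB(3)] 2(2) by (metis mult.assoc subset_refl)
    moreover have "card (kernel G H h) > 0"
      using G.card_subgroup_pos[OF normal_imp_subgroup[OF normal_kernel] fin] .
    ultimately have "card (h ` B) = p * card (h ` A)" by simp
    then show ?thesis unfolding U0_step_def using I 2(1) by blast
  qed
qed

text \<open>Applied to a quotient map followed by an isomorphism onto a group on \<open>nat\<close>, this decides inside \<open>G\<close> whether the
  quotient belongs to \<open>U0 t\<close>.\<close>

lemma U0_steps_epi_iff:
  assumes fin: "finite (carrier G)" and surj: "h ` carrier G = carrier H"
  shows "(U0_step t G)\<^sup>*\<^sup>* (kernel G H h) (carrier G) \<longleftrightarrow> (U0_step t H)\<^sup>*\<^sup>* {\<one>\<^bsub>H\<^esub>} (carrier H)"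
proof
  assume s: "(U0_step t G)\<^sup>*\<^sup>* (kernel G H h) (carrier G)"
  have "kernel G H h \<subseteq> B \<and> (U0_step t H)\<^sup>*\<^sup>* (h ` kernel G H h) (h ` B)"
    if "(U0_step t G)\<^sup>*\<^sup>* (kernel G H h) B" for B
    using that
  proof (induction rule: rtranclp_induct)
    case (step A B)
    have "U0_step t H (h ` A) (h ` B)"
      using step.IH by (intro U0_step_image[OF fin surj step.hyps(2)]) blast
    then have "(U0_step t H)\<^sup>*\<^sup>* (h ` kernel G H h) (h ` B)"
      using step.IH by (blast intro: rtranclp.rtrancl_into_rtrancl)
    moreover have "A \<subseteq> B" using step.hyps(2) by (simp add: U0_step_def)
    ultimately show ?case using step.IH by blast
  qed simp
  moreover have "h ` kernel G H h = {\<one>\<^bsub>H\<^esub>}" using G.one_closed hom_one by (force simp: kernel_def)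
  ultimately show "(U0_step t H)\<^sup>*\<^sup>* {\<one>\<^bsub>H\<^esub>} (carrier H)" using s surj by metis
next
  assume s: "(U0_step t H)\<^sup>*\<^sup>* {\<one>\<^bsub>H\<^esub>} (carrier H)"
  have "(U0_step t G)\<^sup>*\<^sup>* {x \<in> carrier G. h x \<in> {\<one>\<^bsub>H\<^esub>}} {x \<in> carrier G. h x \<in> carrier H}" using s
  proof (induction rule: rtranclp_induct)
    case (step A B)
    show ?case by (rule rtranclp.rtrancl_into_rtrancl[OF step.IH U0_step_preimage[OF fin surj step.hyps(2)]])
  qed simp
  moreover have "{x \<in> carrier G. h x \<in> {\<one>\<^bsub>H\<^esub>}} = kernel G H h" by (simp add: kernel_def)
  moreover have "{x \<in> carrier G. h x \<in> carrier H} = carrier G" by auto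
  ultimately show "(U0_step t G)\<^sup>*\<^sup>* (kernel G H h) (carrier G)" by simp
qed

end

lemma mem_U0_iff:
  assumes "finite_group K"
  shows "K \<in> U0 t \<longleftrightarrow> (U0_step t K)\<^sup>*\<^sup>* {\<one>\<^bsub>K\<^esub>} (carrier K)"
  using assms group.supersoluble_KP_sylows_iff[of K t] by (simp add: U0_def finite_group_def)

lemma (in normal) quotient_in_U0_iff:
  assumes fin: "finite (carrier G)"
  shows "in_class (G Mod H) (U0 t) \<longleftrightarrow> (U0_step t G)\<^sup>*\<^sup>* H (carrier G)"
proof -
  interpret q: group_hom G "G Mod H" "\<lambda>x. H #> x" by (rule quotient_hom)
  have fq: "finite_group (G Mod H)"
    using fin factorgroup_is_group by (simp add: finite_group_def carrier_FactGroup)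
  have key: "K \<in> U0 t \<longleftrightarrow> (U0_step t G)\<^sup>*\<^sup>* H (carrier G)"
    if K: "finite_group K" "G Mod H \<cong> K" for K :: "nat monoid"
  proof -
    obtain f where f: "f \<in> iso (G Mod H) K" using K(2) by (auto simp: is_iso_def)
    have gK: "group K" using K(1) by (simp add: finite_group_def)
    interpret f: group_hom "G Mod H" K f
      using f gK factorgroup_is_group by (intro group_hom.intro group_hom_axioms.intro) (auto simp: iso_def)
    have hom: "f \<circ> (\<lambda>x. H #> x) \<in> hom G K" by (rule Group.hom_compose[OF q.homh f.homh])
    interpret e: group_hom G K "f \<circ> (\<lambda>x. H #> x)"
      using hom gK is_group by (intro group_hom.intro group_hom_axioms.intro)
    have bij: "bij_betw f (carrier (G Mod H)) (carrier K)" using f by (simp add: iso_def)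
    have surj: "(f \<circ> (\<lambda>x. H #> x)) ` carrier G = carrier K"
      using bij unfolding image_comp[symmetric] by (simp add: bij_betw_def carrier_FactGroup)
    have "f (H #> x) = \<one>\<^bsub>K\<^esub> \<longleftrightarrow> x \<in> H" if x: "x \<in> carrier G" for x
    proof -
      have "f (H #> x) = \<one>\<^bsub>K\<^esub> \<longleftrightarrow> f (H #> x) = f \<one>\<^bsub>G Mod H\<^esub>" using f.hom_one by metis
      also have "\<dots> \<longleftrightarrow> H #> x = \<one>\<^bsub>G Mod H\<^esub>"
        using bij q.hom_closed[OF x] q.H.one_closed unfolding bij_betw_def inj_on_def by metis
      finally show ?thesis using coset_eq_self_iff[OF x] by simp
    qed
    then have "kernel G K (f \<circ> (\<lambda>x. H #> x)) = H" using subset by (auto simp: kernel_def)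
    then show ?thesis using e.U0_steps_epi_iff[OF fin surj, of t] mem_U0_iff[OF K(1), of t] by simp
  qed
  show ?thesis
  proof
    assume "in_class (G Mod H) (U0 t)"
    then show "(U0_step t G)\<^sup>*\<^sup>* H (carrier G)" using key unfolding in_class_def by blast
  next
    assume s: "(U0_step t G)\<^sup>*\<^sup>* H (carrier G)"
    obtain K :: "nat monoid" where "finite_group K" "G Mod H \<cong> K"
      using finite_group_iso_nat[OF fq] by blast
    then show "in_class (G Mod H) (U0 t)" using key s fq unfolding in_class_def by blast
  qed
qed

text \<open>The normal subgroups with quotient in \<open>U0 t\<close> are closed under intersection, so one of minimal
  cardinality is contained in all others; hence \<open>LEAST\<close> in the definition of \<open>residual\<close> denotes it.\<close>

lemma (in group) residual_U0:
  assumes fin: "finite (carrier G)"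
  shows "residual (U0 t) G \<lhd> G" and "(U0_step t G)\<^sup>*\<^sup>* (residual (U0 t) G) (carrier G)"
    and "\<And>N. N \<lhd> G \<Longrightarrow> (U0_step t G)\<^sup>*\<^sup>* N (carrier G) \<Longrightarrow> residual (U0 t) G \<subseteq> N"
proof -
  define S where "S = {N. N \<lhd> G \<and> (U0_step t G)\<^sup>*\<^sup>* N (carrier G)}"
  have finS: "finite N" if "N \<in> S" for N
    using that fin finite_subset[OF subgroup.subset[OF normal_imp_subgroup]] by (auto simp: S_def)
  have "carrier G \<lhd> G" using subgroup_self by (simp add: normal_inv_iff)
  then have "carrier G \<in> S" by (simp add: S_def)
  from ex_has_least_nat[of "\<lambda>N. N \<in> S", OF this, of card] obtain R where
    R: "R \<in> S" "\<And>N. N \<in> S \<Longrightarrow> card R \<le> card N" by blast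
  have RS: "R \<subseteq> N" if N: "N \<in> S" for N
  proof -
    have "R \<inter> N \<in> S" using U0_steps_Int[OF fin, of R t N] normal_subgroup_intersect R(1) N
      by (simp add: S_def)
    then have "R \<inter> N = R" using R(2) finS[OF R(1)] by (intro card_seteq) auto
    then show ?thesis by blast
  qed
  have "residual (U0 t) G = (LEAST N. N \<in> S)"
    unfolding residual_def S_def using normal.quotient_in_U0_iff[OF _ fin, of _ t]
    by (intro arg_cong[of _ _ Least] ext) auto
  also have "\<dots> = R" using R(1) RS by (intro Least_equality)
  finally have eq: "residual (U0 t) G = R" .
  show "residual (U0 t) G \<lhd> G" "(U0_step t G)\<^sup>*\<^sup>* (residual (U0 t) G) (carrier G)"
    using R(1) unfolding eq by (auto simp: S_def)
  show "residual (U0 t) G \<subseteq> N" if "N \<lhd> G" "(U0_step t G)\<^sup>*\<^sup>* N (carrier G)" for N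
    unfolding eq using RS that by (auto simp: S_def)
qed

definition F_step :: "nat \<Rightarrow> ('a, 'b) monoid_scheme \<Rightarrow> 'a set \<Rightarrow> 'a set \<Rightarrow> bool" where
  "F_step t G A B \<longleftrightarrow> subgroup A G \<and> subgroup B G \<and> A \<subseteq> B \<and> residual (U0 t) (G\<lparr>carrier := B\<rparr>) \<subseteq> A"

lemma (in group) F_subnormal_iff:
  assumes H: "subgroup H G"
  shows "F_subnormal (U0 t) H G \<longleftrightarrow> (F_step t G)\<^sup>*\<^sup>* H (carrier G)"
proof -
  define Q where "Q A B \<longleftrightarrow> A \<subseteq> B \<and> residual (U0 t) (G\<lparr>carrier := B\<rparr>) \<subseteq> A" for A B
  have "(\<lambda>A B. subgroup A G \<and> subgroup B G \<and> Q A B) = F_step t G"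
    by (intro ext) (simp add: F_step_def Q_def)
  then have "F_subnormal (U0 t) H G \<longleftrightarrow> H = carrier G \<or> (F_step t G)\<^sup>*\<^sup>* H (carrier G)"
    unfolding F_subnormal_def using H chain_iff_rtranclp[of H "carrier G" "\<lambda>A. subgroup A G" Q]
    unfolding Q_def by simp
  then show ?thesis by auto
qed

lemma (in group) KP_step_of_subgroup:
  assumes B: "subgroup B G" and s: "KP_step t (G\<lparr>carrier := B\<rparr>) X Y"
  shows "KP_step t G X Y"
proof -
  have sub: "subgroup X (G\<lparr>carrier := B\<rparr>)" "subgroup Y (G\<lparr>carrier := B\<rparr>)" "X \<subseteq> Y"
    using s by (auto simp: KP_step_def)
  then have "subgroup X G" "subgroup Y G" using incl_subgroup[OF B] by auto
  moreover have "Y \<subseteq> B" using subgroup.subset[OF sub(2)] by simp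
  then have "inv\<^bsub>G\<lparr>carrier := B\<rparr>\<^esub> x = inv x" if "x \<in> Y" for x using that m_inv_consistent[OF B] by auto
  ultimately show ?thesis using s unfolding KP_step_def by auto
qed

lemma (in group) KP_steps_of_F_step:
  assumes fin: "finite (carrier G)" and s: "F_step t G A B"
  shows "(KP_step t G)\<^sup>*\<^sup>* A B"
proof -
  have AB: "subgroup A G" "subgroup B G" "A \<subseteq> B" "residual (U0 t) (G\<lparr>carrier := B\<rparr>) \<subseteq> A"
    using s by (auto simp: F_step_def)
  interpret B: group "G\<lparr>carrier := B\<rparr>"
    using AB(2) by (rule subgroup.subgroup_is_group) (rule is_group)
  have finB: "finite (carrier (G\<lparr>carrier := B\<rparr>))"
    using finite_subset[OF subgroup.subset[OF AB(2)] fin] by simp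
  have "subgroup A (G\<lparr>carrier := B\<rparr>)" using AB by (simp add: subgroup_incl)
  from B.KP_steps_of_U0_steps[OF finB B.residual_U0(2)[OF finB, of t]
      normal_imp_subgroup[OF B.residual_U0(1)[OF finB]] this AB(4)]
  have "(KP_step t (G\<lparr>carrier := B\<rparr>))\<^sup>*\<^sup>* A B" by simp
  moreover have "KP_step t (G\<lparr>carrier := B\<rparr>) \<le> KP_step t G"
    using KP_step_of_subgroup[OF AB(2)] by auto
  ultimately show ?thesis using rtranclp_mono by blast
qed

section \<open>The action on a section of prime order\<close>

lemma (in normal) coset_absorb:
  assumes "a \<in> H" "x \<in> carrier G"
  shows "H #> (a \<otimes> x) = H #> x"
  using assms coset_eq_iff[of "a \<otimes> x" x] subset by (auto simp: m_assoc)

lemma (in normal) prime_section_abelian: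
  assumes fin: "finite (carrier G)" and B: "subgroup B G" "H \<subseteq> B"
    and p: "prime p" "card B = p * card H" and x: "x \<in> B" and y: "y \<in> B"
  shows "H #> (x \<otimes> y \<otimes> inv x) = H #> y"
proof -
  have HB: "H \<lhd> (G\<lparr>carrier := B\<rparr>)" by (rule normal_in_subgroup[OF B(1) normal_axioms B(2)])
  have "card H < card B"
    using p card_subgroup_pos[OF subgroup_axioms fin] prime_gt_1_nat[of p] by simp
  then obtain b where b: "b \<in> B" "b \<notin> H"
    using B(2) by (metis less_irrefl subsetI subset_antisym)
  have bc: "b \<in> carrier G" using b B(1) subgroup.mem_carrier by metis
  obtain k :: nat and a where a: "a \<in> H" "x = a \<otimes> b [^] k"
    using prime_index_powers[OF fin B(1) HB p b x] by blast
  obtain l :: nat and c where c: "c \<in> H" "y = c \<otimes> b [^] l"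
    using prime_index_powers[OF fin B(1) HB p b y] by blast
  define z where "z = b [^] l"
  have zc: "z \<in> carrier G" using bc by (simp add: z_def)
  have ac: "a \<in> carrier G" "c \<in> carrier G" using a c subset by auto
  have xc: "x \<in> carrier G" "y \<in> carrier G" using x y B(1) subgroup.mem_carrier by metis+
  have comm: "b [^] k \<otimes> z = z \<otimes> b [^] k" unfolding z_def
    using bc by (simp add: nat_pow_mult add.commute)
  have yz: "H #> y = H #> z" unfolding c(2) z_def using c(1) bc by (intro coset_absorb) auto
  then have "H #> (x \<otimes> y \<otimes> inv x) = H #> (x \<otimes> z \<otimes> inv x)"
    using xc zc by (intro coset_conj_eq) auto
  also have "x \<otimes> z \<otimes> inv x = a \<otimes> (b [^] k \<otimes> z) \<otimes> inv (b [^] k) \<otimes> inv a"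
    unfolding a(2) using ac bc zc by (simp add: m_assoc inv_mult_group)
  also have "\<dots> = (a \<otimes> (z \<otimes> inv a \<otimes> inv z)) \<otimes> z"
    unfolding comm using ac bc zc by (simp add: m_assoc)
  also have "H #> \<dots> = H #> z"
    using a(1) ac zc inv_op_closed2[of z "inv a"] by (intro coset_absorb) auto
  finally show ?thesis using yz by simp
qed

lemma (in group) U0_step_prime_index:
  assumes fin: "finite (carrier G)" and M: "M \<lhd> G" and p: "prime p" "order G = p * card M"
  shows "U0_step t G M (carrier G)"
proof -
  interpret M: normal M G by fact
  have "central_over G M (carrier G)"
    unfolding M.central_over_iff[OF subset_refl]
    using M.prime_section_abelian[OF fin subgroup_self M.subset p(1)] p(2) by (simp add: order_def)
  moreover have "carrier G \<lhd> G" using subgroup_self by (simp add: normal_inv_iff)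
  ultimately show ?thesis unfolding U0_step_def using M M.subset by simp
qed

text \<open>The automorphism group of a group of prime order is abelian: two elements of \<open>G\<close> act on \<open>B/A\<close> as power
  maps, and these commute. So \<open>G\<close> modulo the centralizer of \<open>B/A\<close> is abelian.\<close>

lemma (in group) prime_section_action_commutes:
  assumes fin: "finite (carrier G)" and A: "A \<lhd> G" and B: "B \<lhd> G" and AB: "A \<subseteq> B"
    and p: "prime p" "card B = p * card A"
  shows "central_over G (section_centralizer G A B) (carrier G)"
  unfolding central_over_def
proof (intro ballI)
  fix x y assume x: "x \<in> carrier G" and y: "y \<in> carrier G"
  interpret A: normal A G by fact
  interpret B: normal B G by fact
  have AB': "A \<lhd> (G\<lparr>carrier := B\<rparr>)" by (rule normal_in_subgroup[OF B.subgroup_axioms A AB])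
  have "card A < card B"
    using p card_subgroup_pos[OF A.subgroup_axioms fin] prime_gt_1_nat[of p] by simp
  then obtain b where b: "b \<in> B" "b \<notin> A"
    using AB by (metis less_irrefl subsetI subset_antisym)
  have bc: "b \<in> carrier G" using b B.subset by auto
  have pow: "\<exists>k::int. A #> s = A #> b [^] k" if s: "s \<in> B" for s
  proof -
    obtain k :: nat and a where a: "a \<in> A" "s = a \<otimes> b [^] k"
      using prime_index_powers[OF fin B.subgroup_axioms AB' p b s] by blast
    have "A #> s = A #> b [^] k" unfolding a(2) using a(1) bc by (intro A.coset_absorb) auto
    then have "A #> s = A #> b [^] int k" by (simp add: int_pow_int)
    then show ?thesis by blast
  qed
  obtain i :: int where i: "A #> (x \<otimes> b \<otimes> inv x) = A #> b [^] i"
    using pow B.inv_op_closed2[OF x b(1)] by blast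
  obtain j :: int where j: "A #> (y \<otimes> b \<otimes> inv y) = A #> b [^] j"
    using pow B.inv_op_closed2[OF y b(1)] by blast
  have act: "A #> ((u \<otimes> v) \<otimes> b \<otimes> inv (u \<otimes> v)) = A #> b [^] (m * n)"
    if u: "u \<in> carrier G" "A #> (u \<otimes> b \<otimes> inv u) = A #> b [^] m"
      and v: "v \<in> carrier G" "A #> (v \<otimes> b \<otimes> inv v) = A #> b [^] n" for u v and m n :: int
  proof -
    have "(u \<otimes> v) \<otimes> b \<otimes> inv (u \<otimes> v) = u \<otimes> (v \<otimes> b \<otimes> inv v) \<otimes> inv u"
      using u v bc by (simp add: m_assoc inv_mult_group)
    also have "A #> \<dots> = A #> (u \<otimes> b [^] n \<otimes> inv u)"
      using u v bc by (intro A.coset_conj_eq) auto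
    also have "\<dots> = A #> (u \<otimes> b \<otimes> inv u) [^] n" using u bc by (simp add: conj_int_pow)
    also have "\<dots> = A #> (b [^] m) [^] n" using u bc by (intro A.coset_int_pow_eq) auto
    also have "\<dots> = A #> b [^] (m * n)" using bc by (simp add: int_pow_pow)
    finally show ?thesis .
  qed
  \<comment> \<open>It suffices that \<open>v\<close> and \<open>w\<close> act in the same way on \<open>B/A\<close>.\<close>
  define v where "v = x \<otimes> y"
  define w where "w = y \<otimes> x"
  have vw: "v \<in> carrier G" "w \<in> carrier G" using x y by (auto simp: v_def w_def)
  have gen: "A #> (v \<otimes> b \<otimes> inv v) = A #> (w \<otimes> b \<otimes> inv w)"
    using act[OF x i y j] act[OF y j x i] by (simp add: v_def w_def mult.commute)
  have same: "A #> (v \<otimes> s \<otimes> inv v) = A #> (w \<otimes> s \<otimes> inv w)" if s: "s \<in> B" for s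
  proof -
    obtain k :: int where k: "A #> s = A #> b [^] k" using pow[OF s] by blast
    have sc: "s \<in> carrier G" using s B.subset by auto
    have "A #> (v \<otimes> s \<otimes> inv v) = A #> (v \<otimes> b [^] k \<otimes> inv v)"
      using vw sc bc k by (intro A.coset_conj_eq) auto
    also have "\<dots> = A #> (v \<otimes> b \<otimes> inv v) [^] k" using vw bc by (simp add: conj_int_pow)
    also have "\<dots> = A #> (w \<otimes> b \<otimes> inv w) [^] k"
      using vw bc gen by (intro A.coset_int_pow_eq) auto
    also have "\<dots> = A #> (w \<otimes> b [^] k \<otimes> inv w)" using vw bc by (simp add: conj_int_pow)
    also have "\<dots> = A #> (w \<otimes> s \<otimes> inv w)"
      using vw sc bc k by (intro A.coset_conj_eq) auto
    finally show ?thesis .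
  qed
  have "A #> ((v \<otimes> inv w) \<otimes> s \<otimes> inv (v \<otimes> inv w)) = A #> s" if s: "s \<in> B" for s
  proof -
    define s' where "s' = inv w \<otimes> s \<otimes> w"
    have s': "s' \<in> B" unfolding s'_def using B.inv_op_closed1[OF vw(2) s] .
    have sc: "s \<in> carrier G" using s B.subset by auto
    have "(v \<otimes> inv w) \<otimes> s \<otimes> inv (v \<otimes> inv w) = v \<otimes> s' \<otimes> inv v"
      unfolding s'_def using vw sc by (simp add: m_assoc inv_mult_group)
    also have "A #> \<dots> = A #> (w \<otimes> s' \<otimes> inv w)" by (rule same[OF s'])
    also have "w \<otimes> s' \<otimes> inv w = s"
      unfolding s'_def using conj_inverse_cancel[of "inv w" s] vw sc by simp
    finally show ?thesis .
  qed
  then have "v \<otimes> inv w \<in> section_centralizer G A B" using vw by (simp add: section_centralizer_def)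
  moreover have "x \<otimes> y = (v \<otimes> inv w) \<otimes> y \<otimes> x"
    unfolding v_def w_def using x y by (simp add: m_assoc inv_mult_group)
  ultimately show "\<exists>a\<in>section_centralizer G A B. x \<otimes> y = a \<otimes> y \<otimes> x" by blast
qed

section \<open>Normal series with factors of prime power order\<close>

text \<open>A chain of such steps from \<open>1\<close> to \<open>G\<close> expresses that \<open>G\<close> is soluble, in the form in which solubility enters
  the proof.\<close>

definition primary_step :: "('a, 'b) monoid_scheme \<Rightarrow> 'a set \<Rightarrow> 'a set \<Rightarrow> bool" where
  "primary_step G A B \<longleftrightarrow> A \<lhd> G \<and> B \<lhd> G \<and> A \<subseteq> B \<and> (\<exists>q k. prime q \<and> card B = q ^ k * card A)"

lemma primary_split:
  fixes x y u v q :: nat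
  assumes "prime q" "x * u = q ^ k * (y * v)" "y dvd x" "v dvd u" "y > 0" "v > 0"
  shows "(\<exists>i. x = q ^ i * y) \<and> (\<exists>i. u = q ^ i * v)"
proof -
  obtain m n where mn: "x = y * m" "u = v * n" using assms(3,4) by (auto simp: dvd_def)
  then have "(y * v) * (m * n) = (y * v) * q ^ k" using assms(2) by (simp add: mult_ac)
  then have "m * n = q ^ k" using assms(5,6) by simp
  then have "m dvd q ^ k" "n dvd q ^ k" by (metis dvd_triv_left, metis dvd_triv_right)
  then obtain i j where "m = q ^ i" "n = q ^ j" using divides_primepow_nat[OF assms(1)] by blast
  then show ?thesis using mn by (auto simp: mult.commute)
qed

lemma (in group) primary_index_split:
  assumes fin: "finite (carrier G)" and s: "primary_step G A B" and S: "subgroup S G"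
  shows "\<exists>q. prime q \<and> (\<exists>i. card (B <#> S) = q ^ i * card (A <#> S)) \<and>
    (\<exists>i. card (S \<inter> B) = q ^ i * card (S \<inter> A))"
proof -
  obtain q k where AB: "A \<lhd> G" "B \<lhd> G" "A \<subseteq> B" and q: "prime q" "card B = q ^ k * card A"
    using s by (auto simp: primary_step_def)
  interpret A: normal A G by fact
  interpret B: normal B G by fact
  have sub: "subgroup (A <#> S) G" "subgroup (B <#> S) G" "subgroup (S \<inter> A) G" "subgroup (S \<inter> B) G"
    using A.subgroup_set_mult[OF S] B.subgroup_set_mult[OF S] subgroups_Inter_pair S
      A.subgroup_axioms B.subgroup_axioms by auto
  have le: "A <#> S \<subseteq> B <#> S" "S \<inter> A \<subseteq> S \<inter> B" using AB mono_set_mult[OF AB(3) subset_refl] by auto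
  have "card (B <#> S) * card (S \<inter> B) = q ^ k * (card (A <#> S) * card (S \<inter> A))"
    using A.card_set_mult[OF S fin] B.card_set_mult[OF S fin] q(2) by simp
  then have "(\<exists>i. card (B <#> S) = q ^ i * card (A <#> S)) \<and> (\<exists>i. card (S \<inter> B) = q ^ i * card (S \<inter> A))"
    by (intro primary_split q(1) card_subgroup_dvd card_subgroup_pos sub le fin)
  then show ?thesis using q(1) by blast
qed

lemma (in group) primary_steps_subgroup:
  assumes fin: "finite (carrier G)" and s: "(primary_step G)\<^sup>*\<^sup>* {\<one>} (carrier G)" and S: "subgroup S G"
  shows "(primary_step (G\<lparr>carrier := S\<rparr>))\<^sup>*\<^sup>* {\<one>} S"
proof -
  have restrict: "primary_step (G\<lparr>carrier := S\<rparr>) (S \<inter> A) (S \<inter> B)" if st: "primary_step G A B" for A B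
  proof -
    have AB: "A \<lhd> G" "B \<lhd> G" "A \<subseteq> B" using st by (auto simp: primary_step_def)
    have "(S \<inter> X) \<lhd> (G\<lparr>carrier := S\<rparr>)" if X: "X \<lhd> G" for X
      unfolding normal_subgroup_iff[OF S]
      using subgroups_Inter_pair[OF S normal_imp_subgroup[OF X]] subgroup.mem_carrier[OF S]
        subgroup.m_closed[OF S] subgroup.m_inv_closed[OF S] normal.inv_op_closed2[OF X] by auto
    then show ?thesis unfolding primary_step_def
      using AB primary_index_split[OF fin st S] by blast
  qed
  have "(primary_step (G\<lparr>carrier := S\<rparr>))\<^sup>*\<^sup>* (S \<inter> {\<one>}) (S \<inter> carrier G)" using s
  proof (induction rule: rtranclp_induct)
    case (step A B)
    show ?case by (rule rtranclp.rtrancl_into_rtrancl[OF step.IH restrict[OF step.hyps(2)]])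
  qed simp
  moreover have "S \<inter> {\<one>} = {\<one>}" "S \<inter> carrier G = S"
    using subgroup.one_closed[OF S] subgroup.subset[OF S] by auto
  ultimately show ?thesis by simp
qed

text \<open>Let \<open>U\<close> be the first member of the series with \<open>A <#> U = carrier G\<close> and \<open>T\<close> the one before it. The quotient of \<open>G\<close> by
  \<open>L = A <#> T\<close> is a nontrivial \<open>q\<close>-group. It has a subgroup of index \<open>q\<close>, which is normal.\<close>

lemma (in group) exists_normal_prime_index:
  assumes fin: "finite (carrier G)" and s: "(primary_step G)\<^sup>*\<^sup>* {\<one>} (carrier G)"
    and A: "A \<lhd> G" and ne: "A \<noteq> carrier G"
  shows "\<exists>M p. A \<subseteq> M \<and> M \<lhd> G \<and> prime p \<and> order G = p * card M" (is ?goal)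
proof -
  interpret A: normal A G by fact
  have "A <#> T \<noteq> carrier G \<longrightarrow> ?goal" if "(primary_step G)\<^sup>*\<^sup>* T (carrier G)" for T
    using that
  proof (induction rule: converse_rtranclp_induct)
    case base
    show ?case using set_mult_absorb(1)[OF A.subgroup_axioms subgroup_self A.subset] by simp
  next
    case (step T U)
    have TU: "T \<lhd> G" "U \<lhd> G" "T \<subseteq> U" using step.hyps(1) by (auto simp: primary_step_def)
    show ?case
    proof (cases "A <#> U = carrier G")
      case True
      show ?thesis
      proof
        assume L: "A <#> T \<noteq> carrier G"
        define L where "L = A <#> T"
        have LG: "L \<lhd> G" unfolding L_def by (rule A.normal_set_mult[OF TU(1)])
        interpret L: normal L G by fact
        have AL: "A \<subseteq> L" unfolding L_def by (rule A.subset_set_mult(1)[OF normal_imp_subgroup[OF TU(1)]])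
        have comm: "T <#> A = A <#> T" "U <#> A = A <#> U"
          using commut_normal[OF A.subgroup_axioms TU(1)] commut_normal[OF A.subgroup_axioms TU(2)] by simp_all
        obtain q i where q: "prime q" "card (U <#> A) = q ^ i * card (T <#> A)"
          using primary_index_split[OF fin step.hyps(1) A.subgroup_axioms] by blast
        then have o: "order G = q ^ i * card L" using True by (simp add: comm L_def order_def)
        have "i \<noteq> 0"
        proof
          assume "i = 0"
          then have "card L = card (carrier G)" using o by (simp add: order_def)
          then have "L = carrier G" using card_subset_eq[OF fin L.subset] by simp
          then show False using L by (simp add: L_def)
        qed
        then obtain j where j: "i = Suc j" by (cases i) auto
        have "order G = q ^ j * q * card L" using o j by (simp add: mult_ac)
        then obtain S where S: "subgroup S G" "L \<subseteq> S" "card S = q ^ j * card L"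
          using L.exists_intermediate_subgroup[OF fin q(1)] by blast
        have oS: "order G = q * card S" using o j S(3) by simp
        have "x \<otimes> u \<otimes> inv x \<in> S" if "x \<in> carrier G" "u \<in> S" for x u
        proof (rule conj_mem_if_small_index[OF fin q(1) S(1) subgroup_self _ _ S(2)])
          show "S \<subseteq> carrier G" by (rule subgroup.subset[OF S(1)])
          show "card (carrier G) \<le> q * card S" using oS by (simp add: order_def)
          show "u \<in> S" "x \<in> carrier G" by fact+
          show "u [^] (q ^ i) \<in> L"
            using L.power_index_mem[OF fin _ o] that(2) S(1) subgroup.mem_carrier by metis
        qed (rule L.inv_op_closed2)
        then have "S \<lhd> G" using S(1) by (simp add: normal_inv_iff)
        then show ?goal using AL S(2) q(1) oS by blast
      qed
    qed (use step.IH in blast)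
  qed
  from this[OF s] have "A <#> {\<one>} \<noteq> carrier G \<longrightarrow> ?goal" .
  moreover have "A <#> {\<one>} = A"
    using set_mult_absorb(2)[OF triv_subgroup A.subgroup_axioms] A.one_closed by simp
  ultimately show ?thesis using ne by simp
qed

text \<open>Let \<open>U\<close> be the first member of the series not inside \<open>M\<close> and \<open>T\<close> the one before it. Since \<open>M\<close> has prime
  index, \<open>U <#> M = carrier G\<close>, so \<open>D = M \<inter> U\<close> has index \<open>p\<close> in \<open>U\<close>. As \<open>T \<subseteq> D\<close> and \<open>U/T\<close> is a
  \<open>p\<close>-group, \<open>D\<close> is normal in \<open>U\<close>, hence in \<open>G\<close>. Let \<open>Z\<close> be the centralizer of \<open>U/D\<close> and \<open>R = M \<inter> Z\<close>. Then \<open>R\<close>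
  is normal in \<open>G\<close> and has index \<open>p\<close> in \<open>Z\<close>, and \<open>G/Z\<close> is abelian.\<close>

lemma (in group) U0_steps_below_good_index:
  assumes fin: "finite (carrier G)" and s: "(primary_step G)\<^sup>*\<^sup>* {\<one>} (carrier G)"
    and M: "subgroup M G" and p: "good_prime t p" "order G = p * card M"
  shows "\<exists>R. R \<subseteq> M \<and> R \<lhd> G \<and> (U0_step t G)\<^sup>*\<^sup>* R (carrier G)" (is ?goal)
proof -
  have pp: "prime p" using p(1) by (simp add: good_prime_def)
  have Mpos: "card M > 0" by (rule card_subgroup_pos[OF M fin])
  have "T \<subseteq> M \<longrightarrow> ?goal" if "(primary_step G)\<^sup>*\<^sup>* T (carrier G)" for T
    using that
  proof (induction rule: converse_rtranclp_induct)
    case base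
    have "card M < order G" using p(2) Mpos prime_gt_1_nat[OF pp] by simp
    then have "M \<noteq> carrier G" by (auto simp: order_def)
    then show ?case using subgroup.subset[OF M] by blast
  next
    case (step T U)
    obtain q k where TU: "T \<lhd> G" "U \<lhd> G" "T \<subseteq> U" and q: "prime q" "card U = q ^ k * card T"
      using step.hyps(1) by (auto simp: primary_step_def)
    interpret U: normal U G by fact
    interpret T: normal T G by fact
    show ?case
    proof (cases "U \<subseteq> M")
      case False
      show ?thesis
      proof
        assume TM: "T \<subseteq> M"
        define D where "D = M \<inter> U"
        have D: "subgroup D G" "D \<subseteq> U" "T \<subseteq> D"
          unfolding D_def using subgroups_Inter_pair[OF M U.subgroup_axioms] TM TU by auto
        have W: "subgroup (U <#> M) G" "M \<subseteq> U <#> M" "U \<subseteq> U <#> M"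
          using U.subgroup_set_mult[OF M] U.subset_set_mult[OF M] by auto
        obtain j where j: "card (U <#> M) = card M * j"
          using card_subgroup_dvd[OF M W(1,2)] by (rule dvdE)
        have "card (U <#> M) dvd order G"
          using card_subgroup_dvd[OF W(1) subgroup_self subgroup.subset[OF W(1)]] by (simp add: order_def)
        then have "j dvd p" using j p(2) Mpos by (simp add: mult.commute)
        moreover have "j \<noteq> 1"
        proof
          assume "j = 1"
          then have "M = U <#> M"
            using j finite_subset[OF subgroup.subset[OF W(1)] fin] W(2) by (intro card_subset_eq) auto
          then show False using W(3) False by simp
        qed
        ultimately have "j = p" using pp prime_nat_iff by blast
        then have cW: "card (U <#> M) = card (carrier G)" using j p(2) by (simp add: order_def mult.commute)
        then have UM: "U <#> M = carrier G" by (rule card_subset_eq[OF fin subgroup.subset[OF W(1)]])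
        have "p * card M * card D = card M * card U"
          using U.card_set_mult[OF M fin] cW p(2) by (simp add: D_def order_def)
        then have cU: "card U = p * card D" using Mpos by simp
        have "p = q"
        proof -
          obtain d where d: "card D = card T * d"
            using card_subgroup_dvd[OF T.subgroup_axioms D(1,3)] by (rule dvdE)
          have "card T * (p * d) = p * card D" unfolding d by (simp only: mult_ac)
          also have "\<dots> = card T * q ^ k" using cU q(2) by (simp only: mult_ac)
          finally have "p * d = q ^ k"
            using card_subgroup_pos[OF T.subgroup_axioms fin] by (metis mult_cancel1 not_gr_zero)
          then have "p dvd q ^ k" by (metis dvd_triv_left)
          then show ?thesis using pp q(1) by (metis prime_dvd_power primes_dvd_imp_eq)
        qed
        have decomp: "\<exists>u\<in>U. \<exists>m\<in>M. x = u \<otimes> m" if "x \<in> carrier G" for x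
          using that unfolding UM[symmetric] by (auto simp: set_mult_def)
        \<comment> \<open>A subgroup of index \<open>p\<close> is normal in a \<open>p\<close>-group; here the \<open>p\<close>-group is \<open>U/T\<close>.\<close>
        have Uconj: "x \<otimes> v \<otimes> inv x \<in> D" if x: "x \<in> U" and v: "v \<in> D" for x v
        proof (rule conj_mem_if_small_index[OF fin pp D(1) U.subgroup_axioms D(2) _ D(3)])
          show "card U \<le> p * card D" using cU by simp
          show "v \<in> D" "x \<in> U" by fact+
          show "x \<otimes> l \<otimes> inv x \<in> T" if "x \<in> U" "l \<in> T" for x l
            using that T.inv_op_closed2 U.subset by blast
          interpret TU: normal T "G\<lparr>carrier := U\<rparr>"
            by (rule normal_in_subgroup[OF U.subgroup_axioms TU(1,3)])
          show "v [^] (p ^ k) \<in> T"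
            using TU.power_index_mem[of v "q ^ k"] finite_subset[OF U.subset fin] v D(2) q(2)
              \<open>p = q\<close> nat_pow_consistent[of v "p ^ k" U] by (auto simp: order_def)
        qed
        have DG: "D \<lhd> G"
          unfolding normal_inv_iff
        proof (intro conjI ballI)
          fix x v assume x: "x \<in> carrier G" and v: "v \<in> D"
          obtain u m where um: "u \<in> U" "m \<in> M" "x = u \<otimes> m" using decomp[OF x] by blast
          have c: "u \<in> carrier G" "m \<in> carrier G" "v \<in> carrier G"
            using um v D(1) M U.subset subgroup.mem_carrier by auto
          have "m \<otimes> v \<otimes> inv m \<in> M" using um(2) v M by (simp add: D_def subgroup.m_closed subgroup.m_inv_closed)
          moreover have "m \<otimes> v \<otimes> inv m \<in> U" using U.inv_op_closed2[OF c(2)] v by (simp add: D_def)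
          ultimately have "m \<otimes> v \<otimes> inv m \<in> D" by (simp add: D_def)
          then have "u \<otimes> (m \<otimes> v \<otimes> inv m) \<otimes> inv u \<in> D" by (rule Uconj[OF um(1)])
          moreover have "u \<otimes> (m \<otimes> v \<otimes> inv m) \<otimes> inv u = x \<otimes> v \<otimes> inv x"
            unfolding um(3) using c by (simp add: m_assoc inv_mult_group)
          ultimately show "x \<otimes> v \<otimes> inv x \<in> D" by simp
        qed (rule D(1))
        interpret D: normal D G by fact
        define Z where "Z = section_centralizer G D U"
        have ZG: "Z \<lhd> G" unfolding Z_def by (rule section_centralizer_normal[OF DG TU(2)])
        interpret Z: normal Z G by fact
        have Zfix: "D #> (z \<otimes> u \<otimes> inv z) = D #> u" if "z \<in> Z" "u \<in> U" for z u
          using bspec[OF CollectD[OF that(1)[unfolded Z_def section_centralizer_def], THEN conjunct2] that(2)] .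
        \<comment> \<open>The group \<open>U/D\<close> has prime order, so it is abelian.\<close>
        have UZ: "U \<subseteq> Z"
        proof
          fix u assume u: "u \<in> U"
          have "D #> (u \<otimes> v \<otimes> inv u) = D #> v" if "v \<in> U" for v
            by (rule D.prime_section_abelian[OF fin U.subgroup_axioms D(2) pp cU u that])
          moreover have "u \<in> carrier G" using u U.subset by blast
          ultimately show "u \<in> Z" unfolding Z_def section_centralizer_def by simp
        qed
        define R where "R = M \<inter> Z"
        have R: "subgroup R G" unfolding R_def by (rule subgroups_Inter_pair[OF M Z.subgroup_axioms])
        have RG: "R \<lhd> G"
          unfolding normal_inv_iff
        proof (intro conjI ballI)
          fix x r assume x: "x \<in> carrier G" and r: "r \<in> R"
          obtain u m where um: "u \<in> U" "m \<in> M" "x = u \<otimes> m" using decomp[OF x] by blast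
          have c: "u \<in> carrier G" "m \<in> carrier G" "r \<in> carrier G"
            using um r R M U.subset subgroup.mem_carrier by auto
          define s where "s = m \<otimes> r \<otimes> inv m"
          have sM: "s \<in> M" unfolding s_def using um(2) r M
            by (simp add: R_def subgroup.m_closed subgroup.m_inv_closed)
          have sZ: "s \<in> Z" unfolding s_def using Z.inv_op_closed2[OF c(2)] r by (simp add: R_def)
          have sc: "s \<in> carrier G" using c by (simp add: s_def)
          have "D #> (s \<otimes> inv u \<otimes> inv s) = D #> inv u" using Zfix[OF sZ] um(1) by simp
          then have "s \<otimes> inv u \<otimes> inv s \<otimes> inv (inv u) \<in> D" using D.coset_eq_iff c sc by simp
          \<comment> \<open>Since \<open>s\<close> centralizes \<open>U/D\<close>, it differs from its conjugate by \<open>u\<close> only by an element of \<open>D \<subseteq> M\<close>.\<close>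
          then have "u \<otimes> (s \<otimes> inv u \<otimes> inv s \<otimes> inv (inv u)) \<otimes> inv u \<in> M"
            using D.inv_op_closed2[OF c(1)] by (auto simp: D_def)
          then have "u \<otimes> (s \<otimes> inv u \<otimes> inv s \<otimes> inv (inv u)) \<otimes> inv u \<otimes> s \<in> M"
            using sM subgroup.m_closed[OF M] by blast
          moreover have "u \<otimes> (s \<otimes> inv u \<otimes> inv s \<otimes> inv (inv u)) \<otimes> inv u \<otimes> s = x \<otimes> r \<otimes> inv x"
          proof -
            have cancel: "y \<otimes> (inv y \<otimes> z) = z" if "y \<in> carrier G" "z \<in> carrier G" for y z
              using that m_assoc[of y "inv y" z] by simp
            have "u \<otimes> (s \<otimes> inv u \<otimes> inv s \<otimes> inv (inv u)) \<otimes> inv u \<otimes> s = u \<otimes> s \<otimes> inv u"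
              using c sc cancel[of u s] by (simp add: m_assoc)
            also have "\<dots> = x \<otimes> r \<otimes> inv x"
              unfolding um(3) s_def using c by (simp add: m_assoc inv_mult_group)
            finally show ?thesis .
          qed
          ultimately have "x \<otimes> r \<otimes> inv x \<in> M" by simp
          moreover have "x \<otimes> r \<otimes> inv x \<in> Z" using Z.inv_op_closed2[OF x] r by (simp add: R_def)
          ultimately show "x \<otimes> r \<otimes> inv x \<in> R" by (simp add: R_def)
        qed (rule R)
        have "Z <#> M = carrier G"
          using mono_set_mult[OF UZ subset_refl, of G M] UM subgroup.subset[OF Z.subgroup_set_mult[OF M]] by auto
        then have "p * card M * card R = card M * card Z"
          using Z.card_set_mult[OF M fin] p(2) by (simp add: R_def order_def)
        then have "card Z = p * card R" using Mpos by simp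
        then have st1: "U0_step t G R Z"
          unfolding U0_step_def using RG ZG p(1) by (auto simp: R_def)
        have "carrier G \<lhd> G" using subgroup_self by (simp add: normal_inv_iff)
        then have st2: "U0_step t G Z (carrier G)"
          unfolding U0_step_def using ZG Z.subset
            prime_section_action_commutes[OF fin DG TU(2) D(2) pp cU] by (simp add: Z_def)
        have "(U0_step t G)\<^sup>*\<^sup>* R (carrier G)"
          by (rule converse_rtranclp_into_rtranclp[of "U0_step t G", OF st1 r_into_rtranclp[of "U0_step t G", OF st2]])
        then show ?goal using RG by (auto simp: R_def)
      qed
    qed (use step.IH in blast)
  qed
  from this[OF s] show ?thesis using subgroup.one_closed[OF M] by simp
qed

section \<open>Sylow towers\<close>

lemma (in group) conj_nat_pow:
  assumes "x \<in> carrier G" "y \<in> carrier G"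
  shows "(x \<otimes> y \<otimes> inv x) [^] (k::nat) = x \<otimes> y [^] k \<otimes> inv x"
  using conj_int_pow[OF assms, of "int k"] by (simp add: int_pow_int)

lemma (in normal) conj_set_mult_mem:
  assumes Q: "subgroup Q G" and C: "subgroup C G"
    and conj: "\<And>c u. c \<in> C \<Longrightarrow> u \<in> Q \<Longrightarrow> c \<otimes> u \<otimes> inv c \<in> H <#> Q"
    and x: "x \<in> H <#> C" and y: "y \<in> H <#> Q"
  shows "x \<otimes> y \<otimes> inv x \<in> H <#> Q"
proof -
  obtain a c where a: "a \<in> H" "c \<in> C" "x = a \<otimes> c" using x by (auto simp: set_mult_def)
  obtain b u where b: "b \<in> H" "u \<in> Q" "y = b \<otimes> u" using y by (auto simp: set_mult_def)
  have cc: "a \<in> carrier G" "c \<in> carrier G" "b \<in> carrier G" "u \<in> carrier G"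
    using a b subset subgroup.mem_carrier[OF C] subgroup.mem_carrier[OF Q] by auto
  have L: "subgroup (H <#> Q) G" by (rule subgroup_set_mult[OF Q])
  have HL: "H \<subseteq> H <#> Q" by (rule subset_set_mult(1)[OF Q])
  have cancel: "inv c \<otimes> (c \<otimes> z) = z" if "z \<in> carrier G" for z
    using that cc m_assoc[of "inv c" c z] by simp
  have "x \<otimes> y \<otimes> inv x = a \<otimes> (c \<otimes> b \<otimes> inv c) \<otimes> (c \<otimes> u \<otimes> inv c) \<otimes> inv a"
    unfolding a(3) b(3) using cc cancel by (simp add: m_assoc inv_mult_group)
  moreover have "a \<in> H <#> Q" "inv a \<in> H <#> Q" "c \<otimes> b \<otimes> inv c \<in> H <#> Q"
    using HL a b cc inv_op_closed2 m_inv_closed by auto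
  ultimately show ?thesis using conj[OF a(2) b(2)] subgroup.m_closed[OF L] by simp
qed

text \<open>This is Ore's argument, done modulo the normal subgroup \<open>N\<close>. Along a \<open>KP\<close> chain from \<open>Q\<close> to \<open>G\<close>, each member \<open>C\<close>
  normalizes \<open>L = N <#> Q\<close>. In the next member \<open>D\<close>, the conjugates of \<open>Q\<close> still lie in
  \<open>M = N <#> C\<close>: this is clear if \<open>C\<close> is normal in \<open>D\<close>, and otherwise the
  index of \<open>M\<close> in \<open>N <#> D\<close> is \<open>1\<close> or a prime \<open>r \<le> q\<close>, too small for \<open>Q\<close> to move cosets while it
  fixes one. Since \<open>L\<close> is normal in \<open>M\<close> of index prime to \<open>q\<close>, it contains all \<open>q\<close>-elements of \<open>M\<close>, so
  it contains these conjugates.\<close>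

lemma (in group) largest_prime_normal:
  assumes fin: "finite (carrier G)" and N: "N \<lhd> G" and o: "order G = card N * n"
    and cop: "coprime (card N) n" and q: "prime q" and largest: "\<And>r. prime r \<Longrightarrow> r dvd n \<Longrightarrow> r \<le> q"
    and Q: "sylow_subgroup q Q G" and chain: "(KP_step t G)\<^sup>*\<^sup>* Q (carrier G)"
  shows "(N <#> Q) \<lhd> G"
proof -
  interpret N: normal N G by fact
  have QG: "subgroup Q G" and cQ: "card Q = q ^ multiplicity q (order G)"
    using Q by (auto simp: sylow_subgroup_def)
  define L where "L = N <#> Q"
  have L: "subgroup L G" unfolding L_def by (rule N.subgroup_set_mult[OF QG])
  have NL: "N \<subseteq> L" and QL: "Q \<subseteq> L" unfolding L_def using N.subset_set_mult[OF QG] by auto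
  have opos: "order G > 0" using fin order_gt_0_iff_finite by simp
  have idx: "coprime (card Q) m" if m: "order G = m * card L" for m
  proof -
    obtain l where "card L = card Q * l" using card_subgroup_dvd[OF QG L QL] by (rule dvdE)
    then have dec: "order G = q ^ multiplicity q (order G) * (l * m)" using m cQ by (simp add: mult_ac)
    have "\<not> q dvd l * m"
    proof
      assume "q dvd l * m"
      then have "q ^ Suc (multiplicity q (order G)) dvd order G"
        by (subst dec) (auto simp: mult.commute intro: mult_dvd_mono)
      then have "Suc (multiplicity q (order G)) \<le> multiplicity q (order G)"
        using opos q by (intro multiplicity_geI) auto
      then show False by simp
    qed
    then have "\<not> q dvd m" by auto
    then show ?thesis unfolding cQ using q by (simp add: prime_imp_coprime)
  qed
  have key: "Q \<subseteq> C \<and> subgroup C G \<and> (\<forall>c\<in>C. \<forall>u\<in>Q. c \<otimes> u \<otimes> inv c \<in> L)"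
    if "(KP_step t G)\<^sup>*\<^sup>* Q C" for C
    using that
  proof (induction rule: rtranclp_induct)
    case base
    then show ?case using QG QL by (auto simp: subgroup.m_closed subgroup.m_inv_closed)
  next
    case (step C D)
    have CD: "subgroup C G" "subgroup D G" "C \<subseteq> D" using step.hyps(2) by (auto simp: KP_step_def)
    have QC: "Q \<subseteq> C" and IH: "\<And>c u. c \<in> C \<Longrightarrow> u \<in> Q \<Longrightarrow> c \<otimes> u \<otimes> inv c \<in> N <#> Q"
      using step.IH by (auto simp: L_def)
    define M where "M = N <#> C"
    define K where "K = N <#> D"
    have sub: "subgroup M G" "subgroup K G"
      unfolding M_def K_def using N.subgroup_set_mult CD by auto
    have MK: "M \<subseteq> K" unfolding M_def K_def by (rule mono_set_mult[OF subset_refl CD(3)])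
    have NM: "N \<subseteq> M" and CM: "C \<subseteq> M" and DK: "D \<subseteq> K"
      unfolding M_def K_def using N.subset_set_mult CD by auto
    have LM: "L \<subseteq> M" unfolding L_def M_def by (rule mono_set_mult[OF subset_refl QC])
    have Lnorm: "x \<otimes> y \<otimes> inv x \<in> L" if "x \<in> M" "y \<in> L" for x y
      using N.conj_set_mult_mem[OF QG CD(1) IH] that unfolding L_def M_def by blast
    interpret LM: normal L "G\<lparr>carrier := M\<rparr>"
      unfolding normal_subgroup_iff[OF sub(1)] using L LM Lnorm by blast
    have finM: "finite M" using finite_subset[OF subgroup.subset[OF sub(1)] fin] .
    have conjM: "x \<otimes> u \<otimes> inv x \<in> M" if x: "x \<in> D" and u: "u \<in> Q" for x u
    proof -
      have uC: "u \<in> C" using u QC by auto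
      consider "\<forall>x\<in>D. \<forall>a\<in>C. x \<otimes> a \<otimes> inv x \<in> C" | r where "good_prime t r" "card D = r * card C"
        using step.hyps(2) by (auto simp: KP_step_def)
      then show ?thesis
      proof cases
        case 1
        then show ?thesis using x uC CM by blast
      next
        case 2
        have r: "prime r" using 2 by (simp add: good_prime_def)
        have "card K * card (D \<inter> N) = r * (card M * card (C \<inter> N))"
          unfolding K_def M_def using N.card_set_mult[OF CD(1) fin] N.card_set_mult[OF CD(2) fin] 2(2)
          by (simp add: mult_ac)
        moreover have "card (C \<inter> N) dvd card (D \<inter> N)"
          using CD N.subgroup_axioms by (intro card_subgroup_dvd subgroups_Inter_pair) auto
        ultimately consider "card K = card M" | "card K = r * card M"
          using prime_split[OF r, of "card K" "card (D \<inter> N)" "card M" "card (C \<inter> N)"]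
            card_subgroup_dvd[OF sub MK] card_subgroup_pos[OF sub(1) fin]
            card_subgroup_pos[OF subgroups_Inter_pair[OF CD(1) N.subgroup_axioms] fin] by blast
        then show ?thesis
        proof cases
          case 1
          have "M = K"
            using 1 MK finite_subset[OF subgroup.subset[OF sub(2)] fin] by (intro card_subset_eq) auto
          then have "x \<in> M" "u \<in> M" using x DK uC CM by auto
          then show ?thesis
            using subgroup.m_closed[OF sub(1) subgroup.m_closed[OF sub(1)] subgroup.m_inv_closed[OF sub(1)]]
            by blast
        next
          case 2
          have "r dvd n"
          proof -
            obtain s where s: "card M = card N * s"
              using card_subgroup_dvd[OF N.subgroup_axioms sub(1) NM] by (rule dvdE)
            have "card K dvd order G"
              using card_subgroup_dvd[OF sub(2) subgroup_self subgroup.subset[OF sub(2)]] by (simp add: order_def)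
            then have "card N * (r * s) dvd card N * n" unfolding 2 s o by (simp only: mult_ac)
            then have "r * s dvd n" using card_subgroup_pos[OF N.subgroup_axioms fin]
              by (simp only: nat_mult_dvd_cancel1)
            then show ?thesis by (rule dvd_mult_left)
          qed
          then have rq: "r \<le> q" using largest r by blast
          show ?thesis
          proof (rule conj_mem_if_small_index[OF fin q sub MK _ NM])
            show "card K \<le> q * card M" unfolding 2 using rq by (rule mult_le_mono1)
            show "y \<otimes> l \<otimes> inv y \<in> N" if "y \<in> K" "l \<in> N" for y l
              using that N.inv_op_closed2 subgroup.mem_carrier[OF sub(2)] by blast
            show "u \<in> M" "x \<in> K" using uC CM x DK by auto
            show "u [^] (q ^ multiplicity q (order G)) \<in> N"
              using subgroup_pow_card_eq_one[OF QG fin u] cQ N.one_closed by simp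
          qed
        qed
      qed
    qed
    have "x \<otimes> u \<otimes> inv x \<in> L" if x: "x \<in> D" and u: "u \<in> Q" for x u
    proof -
      obtain m where m: "card M = m * card L"
        using card_subgroup_dvd[OF L sub(1) LM] by (metis dvd_def mult.commute)
      obtain k where "order G = k * card M"
        using card_subgroup_dvd[OF sub(1) subgroup_self subgroup.subset[OF sub(1)]]
        by (metis dvd_def mult.commute order_def)
      then have "order G = (k * m) * card L" using m by simp
      then have "coprime (card Q) (k * m)" by (rule idx)
      then have cm: "coprime (card Q) m" by simp
      have c: "x \<in> carrier G" "u \<in> carrier G"
        using x u subgroup.mem_carrier[OF CD(2)] subgroup.mem_carrier[OF QG] by auto
      have "(x \<otimes> u \<otimes> inv x) [^] card Q = \<one>"
        using conj_nat_pow[OF c] subgroup_pow_card_eq_one[OF QG fin u] c by simp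
      then have "(x \<otimes> u \<otimes> inv x) [^]\<^bsub>G\<lparr>carrier := M\<rparr>\<^esub> card Q \<in> L"
        using nat_pow_consistent[of "x \<otimes> u \<otimes> inv x" "card Q" M] subgroup.one_closed[OF L] by simp
      then show ?thesis
        using LM.coprime_power_mem[OF _ _ _ _ cm] conjM[OF x u] finM m by (simp add: order_def)
    qed
    then show ?case using QC CD by blast
  qed
  have conjG: "c \<otimes> u \<otimes> inv c \<in> N <#> Q" if "c \<in> carrier G" "u \<in> Q" for c u
    using key[OF chain] that by (simp add: L_def)
  have "N <#> carrier G = carrier G"
    by (rule set_mult_absorb(1)[OF N.subgroup_axioms subgroup_self N.subset])
  then show ?thesis
    using L N.conj_set_mult_mem[OF QG subgroup_self conjG] unfolding normal_inv_iff L_def by blast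
qed

text \<open>This is a Sylow tower. The induction climbs through normal Hall subgroups \<open>N\<close>, each time multiplying by a Sylow
  subgroup for the largest prime that divides the index of \<open>N\<close>.\<close>

lemma (in group) primary_steps_of_KP_sylows:
  assumes fin: "finite (carrier G)"
    and syl: "\<And>q P. sylow_subgroup q P G \<Longrightarrow> (KP_step t G)\<^sup>*\<^sup>* P (carrier G)"
  shows "(primary_step G)\<^sup>*\<^sup>* {\<one>} (carrier G)"
proof -
  have "(primary_step G)\<^sup>*\<^sup>* N (carrier G)"
    if "N \<lhd> G" "order G = card N * n" "coprime (card N) n" for N n
    using that
  proof (induction n arbitrary: N rule: less_induct)
    case (less n)
    interpret N: normal N G by fact
    have opos: "order G > 0" using fin order_gt_0_iff_finite by simp
    then have npos: "n > 0" using less.prems(2) by (cases n) auto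
    show ?case
    proof (cases "n = 1")
      case True
      then have "N = carrier G"
        using less.prems(2) card_subset_eq[OF fin N.subset] by (simp add: order_def)
      then show ?thesis by simp
    next
      case False
      define S where "S = {r. prime r \<and> r dvd n}"
      have "S \<subseteq> {..n}" using npos by (auto simp: S_def dest: dvd_imp_le)
      then have finS: "finite S" by (rule finite_subset) simp
      have neS: "S \<noteq> {}" using prime_factor_nat[OF False] by (auto simp: S_def)
      define q where "q = Max S"
      have q: "prime q" "q dvd n" using Max_in[OF finS neS] by (auto simp: q_def S_def)
      have largest: "r \<le> q" if "prime r" "r dvd n" for r
        using that finS by (auto simp: q_def S_def)
      obtain Q where Q: "sylow_subgroup q Q G" using exists_sylow[OF fin q(1)] by blast
      have QG: "subgroup Q G" and cQ: "card Q = q ^ multiplicity q (order G)"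
        using Q by (auto simp: sylow_subgroup_def)
      have L: "(N <#> Q) \<lhd> G"
        using fin less.prems q(1) largest Q syl[OF Q] by (rule largest_prime_normal)
      have "\<not> q dvd card N"
        using q coprime_common_divisor_nat[OF less.prems(3)] not_prime_1 by blast
      then have cNQ: "coprime (card N) (card Q)"
        unfolding cQ using q(1) by (simp add: coprime_commute prime_imp_coprime)
      have "card (Q \<inter> N) dvd card N" "card (Q \<inter> N) dvd card Q"
        using QG N.subgroup_axioms by (auto intro!: card_subgroup_dvd subgroups_Inter_pair)
      then have "card (Q \<inter> N) = 1" by (rule coprime_common_divisor_nat[OF cNQ])
      then have cL: "card (N <#> Q) = card Q * card N" using N.card_set_mult[OF QG fin] by simp
      have NL: "N \<subseteq> N <#> Q" by (rule N.subset_set_mult(1)[OF QG])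
      have st: "primary_step G N (N <#> Q)"
        unfolding primary_step_def using less.prems(1) L NL q(1) cL cQ by auto
      have "card Q dvd card N * n"
        using card_subgroup_dvd[OF QG subgroup_self subgroup.subset[OF QG]] less.prems(2) by (simp add: order_def)
      then have "card Q dvd n" using cNQ by (metis coprime_commute coprime_dvd_mult_right_iff)
      then obtain m where m: "n = card Q * m" by (rule dvdE)
      have oL: "order G = card (N <#> Q) * m" using less.prems(2) cL m by (simp add: mult_ac)
      have "q dvd order G" using q(2) less.prems(2) by simp
      then have "multiplicity q (order G) > 0"
        using opos q(1) by (simp add: prime_multiplicity_gt_zero_iff)
      with prime_gt_1_nat[OF q(1)] have "card Q > 1" unfolding cQ by (rule one_less_power)
      then have "m < n" using m npos by simp
      moreover have "coprime (card (N <#> Q)) m"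
      proof -
        have "coprime (card N) m" using less.prems(3) m by simp
        moreover have "\<not> q dvd m"
        proof
          assume "q dvd m"
          then have "q * card Q dvd order G" unfolding less.prems(2) m by (auto intro!: dvd_mult mult_dvd_mono simp: mult.commute)
          then have "q ^ Suc (multiplicity q (order G)) dvd order G" by (simp add: cQ)
          then have "Suc (multiplicity q (order G)) \<le> multiplicity q (order G)"
            using opos q(1) by (intro multiplicity_geI) auto
          then show False by simp
        qed
        then have "coprime (card Q) m" unfolding cQ using q(1) by (simp add: prime_imp_coprime)
        ultimately show ?thesis by (simp add: cL)
      qed
      ultimately have "(primary_step G)\<^sup>*\<^sup>* (N <#> Q) (carrier G)" by (rule less.IH[OF _ L oL])
      with st show ?thesis by (rule converse_rtranclp_into_rtranclp)
    qed
  qed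
  from this[OF one_is_normal, of "order G"] show ?thesis by simp
qed

section \<open>From one kind of chain to the other\<close>

lemma (in group) F_step_if_U0_steps:
  assumes A: "subgroup A G" and B: "subgroup B G" "A \<subseteq> B" and fin: "finite (carrier G)"
    and R: "R \<subseteq> A" "R \<lhd> (G\<lparr>carrier := B\<rparr>)" "(U0_step t (G\<lparr>carrier := B\<rparr>))\<^sup>*\<^sup>* R B"
  shows "F_step t G A B"
proof -
  interpret B: group "G\<lparr>carrier := B\<rparr>"
    using B(1) by (rule subgroup.subgroup_is_group) (rule is_group)
  have "finite (carrier (G\<lparr>carrier := B\<rparr>))"
    using finite_subset[OF subgroup.subset[OF B(1)] fin] by simp
  then have "residual (U0 t) (G\<lparr>carrier := B\<rparr>) \<subseteq> R" using B.residual_U0(3) R by simp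
  then show ?thesis unfolding F_step_def using A B R(1) by auto
qed

text \<open>A normal step is refined from the top: there is a normal subgroup \<open>M\<close> of \<open>B\<close> of prime index above \<open>A\<close>, the quotient is
  abelian, and \<open>A\<close> is normal in \<open>M\<close>. A step of good prime index is a single \<open>F\<close>-subnormal step.\<close>

lemma (in group) F_steps_of_KP_step:
  assumes fin: "finite (carrier G)" and tower: "(primary_step G)\<^sup>*\<^sup>* {\<one>} (carrier G)"
    and s: "KP_step t G A B"
  shows "(F_step t G)\<^sup>*\<^sup>* A B"
proof -
  have AB: "subgroup A G" "subgroup B G" "A \<subseteq> B" using s by (auto simp: KP_step_def)
  consider "\<forall>x\<in>B. \<forall>a\<in>A. x \<otimes> a \<otimes> inv x \<in> A" | p where "good_prime t p" "card B = p * card A"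
    using s by (auto simp: KP_step_def)
  then show ?thesis
  proof cases
    case 1
    then show ?thesis using AB
    proof (induction "card B" arbitrary: B rule: less_induct)
      case less
      have AnB: "A \<lhd> (G\<lparr>carrier := B\<rparr>)" unfolding normal_subgroup_iff[OF less.prems(3)] using less.prems by blast
      interpret B: group "G\<lparr>carrier := B\<rparr>"
        using less.prems(3) by (rule subgroup.subgroup_is_group) (rule is_group)
      have finB: "finite B" by (rule finite_subset[OF subgroup.subset[OF less.prems(3)] fin])
      show ?case
      proof (cases "A = B")
        case False
        then obtain M p where M: "A \<subseteq> M" "M \<lhd> (G\<lparr>carrier := B\<rparr>)" "prime p" "card B = p * card M"
          using B.exists_normal_prime_index[OF _ _ AnB] finB primary_steps_subgroup[OF fin tower less.prems(3)]
          by (auto simp: order_def)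
        have MG: "subgroup M G" "M \<subseteq> B" using M(2) unfolding normal_subgroup_iff[OF less.prems(3)] by auto
        have "U0_step t (G\<lparr>carrier := B\<rparr>) M B"
          using B.U0_step_prime_index[OF _ M(2,3)] finB M(4) by (simp add: order_def)
        then have st: "F_step t G M B"
          using F_step_if_U0_steps[OF MG(1) less.prems(3) MG(2) fin subset_refl M(2)] by blast
        have "card M < card B"
          using M(3,4) card_subgroup_pos[OF MG(1) fin] prime_gt_1_nat[of p] by simp
        then have "(F_step t G)\<^sup>*\<^sup>* A M"
          using less.hyps[of M] less.prems MG M(1) by blast
        then show ?thesis using st by (rule rtranclp.rtrancl_into_rtrancl)
      qed simp
    qed
  next
    case 2
    interpret B: group "G\<lparr>carrier := B\<rparr>"
      using AB(2) by (rule subgroup.subgroup_is_group) (rule is_group)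
    have finB: "finite (carrier (G\<lparr>carrier := B\<rparr>))"
      using finite_subset[OF subgroup.subset[OF AB(2)] fin] by simp
    have "subgroup A (G\<lparr>carrier := B\<rparr>)" using AB by (simp add: subgroup_incl)
    then obtain R where "R \<subseteq> A" "R \<lhd> (G\<lparr>carrier := B\<rparr>)" "(U0_step t (G\<lparr>carrier := B\<rparr>))\<^sup>*\<^sup>* R B"
      using B.U0_steps_below_good_index[OF finB _ _ 2(1)] primary_steps_subgroup[OF fin tower AB(2)] 2(2)
      by (auto simp: order_def)
    then have "F_step t G A B" by (rule F_step_if_U0_steps[OF AB fin])
    then show ?thesis by (rule r_into_rtranclp)
  qed
qed

lemma (in group) KP_sylows_iff_F_sylows:
  assumes fin: "finite (carrier G)"
  shows "(\<forall>q P. sylow_subgroup q P G \<longrightarrow> KP_subnormal t P G) \<longleftrightarrow>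
    (\<forall>q P. sylow_subgroup q P G \<longrightarrow> F_subnormal (U0 t) P G)"
proof
  assume KP: "\<forall>q P. sylow_subgroup q P G \<longrightarrow> KP_subnormal t P G"
  have syl: "(KP_step t G)\<^sup>*\<^sup>* P (carrier G)" if "sylow_subgroup q P G" for q P
    using KP that KP_subnormal_iff[OF fin] by blast
  have tower: "(primary_step G)\<^sup>*\<^sup>* {\<one>} (carrier G)" by (rule primary_steps_of_KP_sylows[OF fin syl])
  have "KP_step t G \<le> (F_step t G)\<^sup>*\<^sup>*" using F_steps_of_KP_step[OF fin tower] by blast
  then have "(KP_step t G)\<^sup>*\<^sup>* \<le> (F_step t G)\<^sup>*\<^sup>*" by (metis rtranclp_mono rtranclp_idemp)
  then show "\<forall>q P. sylow_subgroup q P G \<longrightarrow> F_subnormal (U0 t) P G"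
    using syl F_subnormal_iff unfolding sylow_subgroup_def by blast
next
  assume F: "\<forall>q P. sylow_subgroup q P G \<longrightarrow> F_subnormal (U0 t) P G"
  have "F_step t G \<le> (KP_step t G)\<^sup>*\<^sup>*" using KP_steps_of_F_step[OF fin] by blast
  then have "(F_step t G)\<^sup>*\<^sup>* \<le> (KP_step t G)\<^sup>*\<^sup>*" by (metis rtranclp_mono rtranclp_idemp)
  then show "\<forall>q P. sylow_subgroup q P G \<longrightarrow> KP_subnormal t P G"
    using F F_subnormal_iff KP_subnormal_iff[OF fin] unfolding sylow_subgroup_def by blast
qed

text \<open>A group of order \<open>p\<close> belongs to the class \<open>U0 t\<close>, whether or not \<open>p\<close> is good, because it is
  abelian. Such a group is found inside \<open>G\<close>.\<close>

lemma (in group) group_primes_subset_U0: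
  assumes fin: "finite (carrier G)"
  shows "group_primes G \<subseteq> class_primes (U0 t)"
proof
  fix p assume "p \<in> group_primes G"
  then have p: "prime p" "p dvd order G" by (auto simp: group_primes_def)
  then obtain m where "order G = p ^ 1 * m" by auto
  then obtain P where P: "subgroup P G" "card P = p ^ 1" using sylow_thm[OF p(1) is_group _ fin] by blast
  interpret P: group "G\<lparr>carrier := P\<rparr>"
    using P(1) by (rule subgroup.subgroup_is_group) (rule is_group)
  have finP: "finite (carrier (G\<lparr>carrier := P\<rparr>))"
    using finite_subset[OF subgroup.subset[OF P(1)] fin] by simp
  interpret I: normal "{\<one>}" "G\<lparr>carrier := P\<rparr>" using P.one_is_normal by simp
  have "U0_step t (G\<lparr>carrier := P\<rparr>) {\<one>} (carrier (G\<lparr>carrier := P\<rparr>))"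
    using P(2) by (intro P.U0_step_prime_index[OF finP I.normal_axioms p(1)]) (simp add: order_def)
  then have "in_class (G\<lparr>carrier := P\<rparr> Mod {\<one>}) (U0 t)"
    unfolding I.quotient_in_U0_iff[OF finP] by (rule r_into_rtranclp)
  then obtain K :: "nat monoid" where K: "K \<in> U0 t" "finite_group K" "G\<lparr>carrier := P\<rparr> Mod {\<one>} \<cong> K"
    unfolding in_class_def by blast
  have "order K = order (G\<lparr>carrier := P\<rparr> Mod {\<one>})" using K(3) iso_same_order unfolding is_iso_def by fastforce
  also have "\<dots> = p"
    using P.lagrange[OF I.subgroup_axioms] P(2) by (simp add: order_def FactGroup_def)
  finally have "p \<in> group_primes K" using p(1) by (simp add: group_primes_def)
  then show "p \<in> class_primes (U0 t)" using K unfolding class_primes_def by blast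
qed

theorem mainTheorem4:
  fixes G :: "('a, 'b) monoid_scheme" and t :: nat
  assumes "t \<ge> 1"
  shows "(in_H t G \<longleftrightarrow>
            finite_group G \<and> (\<forall>q P. sylow_subgroup q P G \<longrightarrow> F_subnormal (U0 t) P G))
       \<and> (in_H t G \<longleftrightarrow> in_w (U0 t) G)"
proof (cases "finite_group G")
  case True
  then interpret group G by (simp add: finite_group_def)
  have fin: "finite (carrier G)" using True by (simp add: finite_group_def)
  show ?thesis
    unfolding in_H_def in_w_def
    using True KP_sylows_iff_F_sylows[OF fin, of t] group_primes_subset_U0[OF fin, of t] by simp
qed (simp add: in_H_def in_w_def)

end
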